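(* Let $A$ be a finite alphabet equipped with a total order $<$. Given an $\mathbb{N}$-rational series $s$ over $A^{*}$ (for instance, given by a finite $\mathbb{N}$-representation $(\lambda,\mu,\nu)$), it is decidable whether $s$ is the enumerating series of some abstract numeration system $(L,A,<)$, i.e. whether there exists an infinite language $L\subseteq A^{*}$ with $s=\mathsf{E}_L$.
   Context: The radix order $\prec$ on $A^{*}$ (strict version) is defined by $u\prec v$ if either $|u|<|v|$, or $|u|=|v|$, $u=wau'$, $v=wbv'$ with letters $a<b$. An abstract numeration system (ANS) is a triple $(L,A,<)$ where $L\subseteq A^{*}$ is an infinite language; every $n\in\mathbb{N}$ is represented by the $(n+1)$-th word of $L$ in the radix order, and for $w\in L$ the value $\mathrm{val}_L(w)$ is the integer $n$ whose representation is $w$ (i.e. the number of words of $L$ strictly smaller than $w$ in radix order). The enumerating series of the ANS is the $\mathbb{N}$-series $\mathsf{E}_L=\sum_{w\in L}(\mathrm{val}_L(w)+1)\,w$, i.e. the map $A^{*}\to\mathbb{N}$ sending $w\in L$ to $\mathrm{val}_L(w)+1$ and words outside $L$ to $0$. An $\mathbb{N}$-series $s:A^{*}\to\mathbb{N}$ is $\mathbb{N}$-rational (equivalently $\mathbb{N}$-recognisable) if there exist $n$, a monoid morphism $\mu:A^{*}\to\mathbb{N}^{n\times n}$, a row vector $\lambda\in\mathbb{N}^{1\times n}$ and a column vector $\nu\in\mathbb{N}^{n\times 1}$ with $s(w)=\lambda\mu(w)\nu$ for all $w\in A^{*}$. *)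

theory Defs
  imports "HOL-Library.Nat_Bijection" "Jordan_Normal_Form.Matrix"
begin

section \<open>Computability\<close>

text \<open>
  The total recursive functions in Kleene's sense: minimisation is only applied to functions for
  which a zero exists for all arguments. A function of arity \<open>k\<close> is modelled on lists; only its
  values on lists of length \<open>k\<close> are meaningful. In primitive recursion and minimisation the
  recursion (resp.\ search) variable is the first argument.
\<close>

inductive total_recursive :: "nat \<Rightarrow> (nat list \<Rightarrow> nat) \<Rightarrow> bool" where
  zero: "total_recursive k (\<lambda>xs. 0)"
| succ: "total_recursive 1 (\<lambda>xs. Suc (xs ! 0))"
| proj: "i < k \<Longrightarrow> total_recursive k (\<lambda>xs. xs ! i)"
| comp: "\<lbrakk>total_recursive (length gs) f; \<And>g. g \<in> set gs \<Longrightarrow> total_recursive k g\<rbrakk>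
    \<Longrightarrow> total_recursive k (\<lambda>xs. f (map (\<lambda>g. g xs) gs))"
| prec: "\<lbrakk>total_recursive k f; total_recursive (Suc (Suc k)) g\<rbrakk>
    \<Longrightarrow> total_recursive (Suc k)
          (\<lambda>xs. rec_nat (f (tl xs)) (\<lambda>y r. g (y # r # tl xs)) (hd xs))"
| minim: "\<lbrakk>total_recursive (Suc k) f; \<And>xs. length xs = k \<Longrightarrow> \<exists>y. f (y # xs) = 0\<rbrakk>
    \<Longrightarrow> total_recursive k (\<lambda>xs. LEAST y. f (y # xs) = 0)"


section \<open>Rational series over the natural numbers\<close>

text \<open>
  The alphabet is the whole of a finite linearly ordered type \<open>'a\<close>. A representation consists of
  its dimension \<open>n\<close>, the row vector \<open>\<lambda>\<close>, the column vector \<open>\<nu>\<close>, and the morphism \<open>\<mu>\<close>, the latter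
  given (as it is in a finite description) by its values on letters.
\<close>

record 'a nrep =
  rdim :: nat
  lam :: "nat vec"
  mu :: "'a \<Rightarrow> nat mat"
  nu :: "nat vec"

definition nrepresentation :: "'a nrep \<Rightarrow> bool" where
  "nrepresentation R \<longleftrightarrow> lam R \<in> carrier_vec (rdim R) \<and> nu R \<in> carrier_vec (rdim R) \<and>
     (\<forall>a. mu R a \<in> carrier_mat (rdim R) (rdim R))"

primrec mu_word :: "'a nrep \<Rightarrow> 'a list \<Rightarrow> nat mat" where
  "mu_word R [] = 1\<^sub>m (rdim R)"
| "mu_word R (a # w) = mu R a * mu_word R w"

definition behaviour :: "'a nrep \<Rightarrow> 'a list \<Rightarrow> nat" where
  "behaviour R w = lam R \<bullet> (mu_word R w *\<^sub>v nu R)"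

definition represents :: "'a nrep \<Rightarrow> ('a list \<Rightarrow> nat) \<Rightarrow> bool" where
  "represents R s \<longleftrightarrow> nrepresentation R \<and> (\<forall>w. s w = behaviour R w)"

definition nrational :: "('a list \<Rightarrow> nat) \<Rightarrow> bool" where
  "nrational s \<longleftrightarrow> (\<exists>R. represents R s)"

lemma mu_word_carrier:
  assumes "nrepresentation R"
  shows "mu_word R w \<in> carrier_mat (rdim R) (rdim R)"
  using assms by (induction w) (auto simp: nrepresentation_def intro: mult_carrier_mat)

lemma mu_word_append:
  assumes "nrepresentation R"
  shows "mu_word R (u @ v) = mu_word R u * mu_word R v"
proof (induction u)
  case Nil
  then show ?case using mu_word_carrier[OF assms, of v] by simp
next
  case (Cons a u)
  have "mu R a \<in> carrier_mat (rdim R) (rdim R)" using assms by (simp add: nrepresentation_def)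
  then show ?case
    using Cons assoc_mult_mat[OF _ mu_word_carrier[OF assms] mu_word_carrier[OF assms]] by simp
qed


section \<open>Deciding properties of rational series\<close>

text \<open>
  A representation is presented to an algorithm as the number coding the list
  \<open>n, \<lambda>, \<mu>(a\<^sub>1), \<dots>, \<mu>(a\<^sub>k), \<nu>\<close> of natural numbers, where \<open>a\<^sub>1 < \<dots> < a\<^sub>k\<close> are the letters and matrices
  are written row by row.
\<close>

definition nrep_code :: "'a::{finite,linorder} nrep \<Rightarrow> nat" where
  "nrep_code R = list_encode (rdim R # list_of_vec (lam R)
     @ concat (map (\<lambda>a. concat (mat_to_list (mu R a))) (sorted_list_of_set UNIV))
     @ list_of_vec (nu R))"

text \<open>
  A property of rational series is decidable if a single recursive function gives the right answer
  for every rational series and every representation of it. No condition is imposed on its values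
  at numbers that are not codes of representations.
\<close>

definition decidable_for_nrational :: "(('a::{finite,linorder} list \<Rightarrow> nat) \<Rightarrow> bool) \<Rightarrow> bool" where
  "decidable_for_nrational P \<longleftrightarrow>
     (\<exists>f. total_recursive 1 f \<and>
        (\<forall>s. nrational s \<longrightarrow>
           (\<forall>R. represents R s \<longrightarrow> f [nrep_code R] = (if P s then 1 else 0))))"

lemma concat_mat_to_list_inj:
  assumes "A \<in> carrier_mat n m" "B \<in> carrier_mat n m"
    and "concat (mat_to_list A) = concat (mat_to_list B)"
  shows "A = B"
proof -
  have "mat_to_list A = mat_to_list B"
    using assms(3)
    by (rule concat_injective) (use assms(1,2) in \<open>auto simp: mat_to_list_def set_zip\<close>)
  then show ?thesis
    using assms(1,2) by (intro eq_matI) (auto simp: mat_to_list_def)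
qed

lemma length_concat_mat_to_list:
  assumes "A \<in> carrier_mat n m"
  shows "length (concat (mat_to_list A)) = n * m"
  using assms by (simp add: mat_to_list_def length_concat comp_def sum_list_triv)

lemma nrep_code_inj:
  fixes R S :: "'a::{finite,linorder} nrep"
  assumes "nrepresentation R" "nrepresentation S" "nrep_code R = nrep_code S"
  shows "R = S"
proof -
  let ?as = "sorted_list_of_set (UNIV :: 'a set)"
  let ?c = "\<lambda>R a. concat (mat_to_list (mu R a))"
  have d: "rdim R = rdim S" and
    eq: "list_of_vec (lam R) @ concat (map (?c R) ?as) @ list_of_vec (nu R)
       = list_of_vec (lam S) @ concat (map (?c S) ?as) @ list_of_vec (nu S)"
    using assms(3) by (simp_all add: nrep_code_def list_encode_eq)
  have cR: "mu R a \<in> carrier_mat (rdim R) (rdim R)" and cS: "mu S a \<in> carrier_mat (rdim R) (rdim R)" for a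
    using assms d by (auto simp: nrepresentation_def)
  have lR: "length (?c R a) = rdim R * rdim R" and lS: "length (?c S a) = rdim R * rdim R" for a
    using length_concat_mat_to_list[OF cR] length_concat_mat_to_list[OF cS] by auto
  have lr: "length (list_of_vec (lam R)) = length (list_of_vec (lam S))"
    and lc: "length (list_of_vec (nu R)) = length (list_of_vec (nu S))"
    using assms d by (auto simp: nrepresentation_def)
  have r: "list_of_vec (lam R) = list_of_vec (lam S)"
    and eq2: "concat (map (?c R) ?as) @ list_of_vec (nu R)
            = concat (map (?c S) ?as) @ list_of_vec (nu S)"
    using eq lr by simp_all
  have m: "concat (map (?c R) ?as) = concat (map (?c S) ?as)"
    and c: "list_of_vec (nu R) = list_of_vec (nu S)"
    using eq2 lc by simp_all
  have "map (?c R) ?as = map (?c S) ?as"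
    using m by (rule concat_injective) (auto simp: set_zip lR lS)
  then have "?c R a = ?c S a" for a
    by (simp only: map_eq_conv) simp
  then have "mu R a = mu S a" for a
    using concat_mat_to_list_inj[OF cR cS] by blast
  then have "mu R = mu S" by blast
  moreover have "lam R = lam S" "nu R = nu S"
    using r c by (metis vec_list)+
  ultimately show ?thesis using d by simp
qed


section \<open>Abstract numeration systems\<close>

definition radix :: "('a::linorder list \<times> 'a list) set" where
  "radix = lenlex {(a, b). a < b}"

definition val :: "'a::linorder list set \<Rightarrow> 'a list \<Rightarrow> nat" where
  "val L w = card {u \<in> L. (u, w) \<in> radix}"

lemma finite_radix_below:
  fixes w :: "'a::{finite,linorder} list"
  shows "finite {u \<in> L. (u, w) \<in> radix}"
proof (rule finite_subset)
  show "{u \<in> L. (u, w) \<in> radix} \<subseteq> {u. set u \<subseteq> UNIV \<and> length u \<le> length w}"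
    by (auto simp: radix_def lenlex_conv)
qed (rule finite_lists_length_le, simp)

definition enumerating_series :: "'a::linorder list set \<Rightarrow> 'a list \<Rightarrow> nat" where
  "enumerating_series L w = (if w \<in> L then val L w + 1 else 0)"

text \<open>The order of the abstract numeration system is that of the type \<open>'a\<close>.\<close>

definition is_ans :: "'a::{finite,linorder} list set \<Rightarrow> bool" where
  "is_ans L \<longleftrightarrow> infinite L"

end

theory Submission
  imports Defs "HOL-Library.Cardinality" "HOL-Library.Infinite_Set"
begin

text \<open>
  If \<open>s\<close> is the enumerating series of \<open>L\<close>, then \<open>L\<close> is the support of \<open>s\<close>. For a rational \<open>s\<close> of
  dimension \<open>n\<close>, the left quotient of the support by \<open>w\<close> depends only on the set of nonzero
  coordinates of \<open>\<lambda>\<mu>(w)\<close>, which takes at most \<open>2\<^sup>n\<close> values. Counting the words below \<open>wv\<close> by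
  their prefixes of length \<open>|w|\<close> then shows that the Hankel matrix of \<open>s - E\<^sub>L\<close> has rank at most
  \<open>2\<^sup>n (n + 2 (2\<^sup>n + 1))\<close>, so that the series vanishes as soon as it vanishes on all words up to
  this length. The set of coordinates of \<open>\<mu>(v)\<nu>\<close> that are nonzero for some \<open>v\<close> of length \<open>l\<close>
  evolves deterministically with \<open>l\<close>, whence \<open>L\<close> is infinite iff it has a word whose length lies
  between \<open>2\<^sup>n\<close> and \<open>2 \<cdot> 2\<^sup>n\<close>. Both conditions are checked by evaluating \<open>s\<close> on finitely many words.
\<close>

section \<open>Recursive functions\<close>

text \<open>
  Unlike \<open>total_recursive\<close>, this notion does not depend on the values at lists of the wrong length.
\<close>

definition recfn :: "nat \<Rightarrow> (nat list \<Rightarrow> nat) \<Rightarrow> bool" where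
  "recfn k f \<longleftrightarrow> (\<exists>g. total_recursive k g \<and> (\<forall>xs. length xs = k \<longrightarrow> f xs = g xs))"

lemma recfnI: "total_recursive k f \<Longrightarrow> recfn k f"
  unfolding recfn_def by blast

lemma recfn_cong:
  assumes "recfn k f" "\<And>xs. length xs = k \<Longrightarrow> f xs = g xs"
  shows "recfn k g"
  using assms unfolding recfn_def by metis

lemma recfn_comp:
  assumes "recfn (length gs) f" "\<And>g. g \<in> set gs \<Longrightarrow> recfn k g"
  shows "recfn k (\<lambda>xs. f (map (\<lambda>g. g xs) gs))"
proof -
  obtain f' where f': "total_recursive (length gs) f'" "\<And>xs. length xs = length gs \<Longrightarrow> f xs = f' xs"
    using assms(1) unfolding recfn_def by blast
  obtain h where h: "\<And>g. g \<in> set gs \<Longrightarrow> total_recursive k (h g)"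
    "\<And>g xs. g \<in> set gs \<Longrightarrow> length xs = k \<Longrightarrow> g xs = h g xs"
    using assms(2) unfolding recfn_def by metis
  have "total_recursive k (\<lambda>xs. f' (map (\<lambda>g. g xs) (map h gs)))"
    using f' h by (intro total_recursive.comp) auto
  then have "recfn k (\<lambda>xs. f' (map (\<lambda>g. g xs) (map h gs)))"
    by (rule recfnI)
  moreover have "f' (map (\<lambda>g. g xs) (map h gs)) = f (map (\<lambda>g. g xs) gs)" if "length xs = k" for xs
  proof -
    have "map (\<lambda>g. g xs) (map h gs) = map (\<lambda>g. g xs) gs"
      using h(2) that by simp
    then show ?thesis by (simp only: f'(2)[of "map (\<lambda>g. g xs) gs"] length_map)
  qed
  ultimately show ?thesis by (rule recfn_cong)
qed

lemma recfn_zero: "recfn k (\<lambda>xs. 0)"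
  by (intro recfnI total_recursive.zero)

lemma recfn_nth: "i < k \<Longrightarrow> recfn k (\<lambda>xs. xs ! i)"
  by (intro recfnI total_recursive.proj)

text \<open>Adds a dummy first argument, so that functions of the parameters can be used under the
  bound variable of a sum or product.\<close>

lemma recfn_tl:
  assumes "recfn k f"
  shows "recfn (Suc k) (\<lambda>xs. f (tl xs))"
proof (rule recfn_cong)
  show "recfn (Suc k) (\<lambda>xs. f (map (\<lambda>g. g xs) (map (\<lambda>i xs. xs ! Suc i) [0..<k])))"
    using assms by (intro recfn_comp) (auto intro: recfn_nth)
  show "f (map (\<lambda>g. g xs) (map (\<lambda>i xs. xs ! Suc i) [0..<k])) = f (tl xs)" if "length xs = Suc k" for xs
  proof -
    have "map (\<lambda>g. g xs) (map (\<lambda>i xs. xs ! Suc i) [0..<k]) = tl xs"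
      using that by (intro nth_equalityI) (auto simp: nth_tl)
    then show ?thesis by simp
  qed
qed

lemma recfn_nth_tl: "Suc i < k \<Longrightarrow> recfn k (\<lambda>xs. tl xs ! i)"
  using recfn_tl[OF recfn_nth, of i "k - 1"] by simp

lemma recfn_nth_tl2: "Suc (Suc i) < k \<Longrightarrow> recfn k (\<lambda>xs. tl (tl xs) ! i)"
  using recfn_tl[OF recfn_nth_tl, of i "k - 1"] by simp

text \<open>In \<open>prec\<close> the recursion variable is the first argument itself; this rule
  puts any recursive function of the other arguments in its place.\<close>

lemma recfn_subst:
  assumes "recfn (Suc k) f" "recfn k b"
  shows "recfn k (\<lambda>xs. f (b xs # xs))"
proof (rule recfn_cong)
  show "recfn k (\<lambda>xs. f (map (\<lambda>g. g xs) (b # map (\<lambda>i xs. xs ! i) [0..<k])))"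
    using assms by (intro recfn_comp) (auto intro: recfn_nth)
  show "f (map (\<lambda>g. g xs) (b # map (\<lambda>i xs. xs ! i) [0..<k])) = f (b xs # xs)" if "length xs = k" for xs
  proof -
    have "map (\<lambda>g. g xs) (map (\<lambda>i xs. xs ! i) [0..<k]) = xs"
      using that by (intro nth_equalityI) auto
    then show ?thesis by simp
  qed
qed

lemma recfn_comp1:
  assumes "recfn 1 (\<lambda>xs. h (xs ! 0))" "recfn k f"
  shows "recfn k (\<lambda>xs. h (f xs))"
proof -
  have "recfn k (\<lambda>xs. (\<lambda>ys. h (ys ! 0)) (map (\<lambda>g. g xs) [f]))"
    using assms by (intro recfn_comp) auto
  then show ?thesis by simp
qed

lemma recfn_comp2:
  assumes "recfn 2 (\<lambda>xs. h (xs ! 0) (xs ! 1))" "recfn k f" "recfn k g"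
  shows "recfn k (\<lambda>xs. h (f xs) (g xs))"
proof -
  have "recfn k (\<lambda>xs. (\<lambda>ys. h (ys ! 0) (ys ! 1)) (map (\<lambda>g. g xs) [f, g]))"
    using assms by (intro recfn_comp) (auto simp: numeral_2_eq_2)
  then show ?thesis by simp
qed

lemma recfn_comp3:
  assumes "recfn 3 (\<lambda>xs. h (xs ! 0) (xs ! 1) (xs ! 2))" "recfn k f" "recfn k g" "recfn k e"
  shows "recfn k (\<lambda>xs. h (f xs) (g xs) (e xs))"
proof -
  have "recfn k (\<lambda>xs. (\<lambda>ys. h (ys ! 0) (ys ! 1) (ys ! 2)) (map (\<lambda>g. g xs) [f, g, e]))"
    using assms by (intro recfn_comp) (auto simp: numeral_3_eq_3)
  then show ?thesis by simp
qed

text \<open>The number of iterations is computed from the parameters, and the step takes counter,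
  accumulated value and parameter list as separate arguments, so that a concrete step is matched by
  unification.\<close>

lemma recfn_rec_nat:
  assumes "recfn k b" "recfn k f" "recfn (Suc (Suc k)) (\<lambda>ys. G (ys ! 0) (ys ! 1) (tl (tl ys)))"
  shows "recfn k (\<lambda>xs. rec_nat (f xs) (\<lambda>y r. G y r xs) (b xs))"
proof -
  obtain f' where f': "total_recursive k f'" "\<And>xs. length xs = k \<Longrightarrow> f xs = f' xs"
    using assms(2) unfolding recfn_def by blast
  obtain g where g: "total_recursive (Suc (Suc k)) g"
      "\<And>ys. length ys = Suc (Suc k) \<Longrightarrow> G (ys ! 0) (ys ! 1) (tl (tl ys)) = g ys"
    using assms(3) unfolding recfn_def by blast
  have "recfn (Suc k) (\<lambda>xs. rec_nat (f' (tl xs)) (\<lambda>y r. g (y # r # tl xs)) (hd xs))"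
    using f' g by (intro recfnI total_recursive.prec)
  from recfn_subst[OF this assms(1)]
  have *: "recfn k (\<lambda>xs. rec_nat (f' xs) (\<lambda>y r. g (y # r # xs)) (b xs))"
    by simp
  have "rec_nat (f' xs) (\<lambda>y r. g (y # r # xs)) m = rec_nat (f xs) (\<lambda>y r. G y r xs) m"
    if "length xs = k" for xs m
    using that f'(2) g(2)[of "_ # _ # xs"] by (induction m) auto
  then show ?thesis by (intro recfn_cong[OF *]) auto
qed

section \<open>Arithmetic operations as recursive functions\<close>

lemma recfn_Suc: "recfn k f \<Longrightarrow> recfn k (\<lambda>xs. Suc (f xs))"
  by (rule recfn_comp1[of Suc, OF recfnI[OF total_recursive.succ]])

lemma recfn_const: "recfn k (\<lambda>xs. c)"
  by (induction c) (auto intro: recfn_zero recfn_Suc)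

lemma recfn_add:
  assumes "recfn k f" "recfn k g"
  shows "recfn k (\<lambda>xs. f xs + g xs)"
proof -
  have "recfn k (\<lambda>xs. rec_nat (f xs) (\<lambda>y r. Suc r) (g xs))"
    by (intro recfn_rec_nat recfn_Suc recfn_nth assms) simp
  moreover have "rec_nat a (\<lambda>y r. Suc r) b = a + b" for a b :: nat
    by (induction b) auto
  ultimately show ?thesis by simp
qed

text \<open>In the recursion behind a bounded sum or product, the second argument is the accumulated
  value, which the summand or factor must not see.\<close>

lemma recfn_drop_second:
  assumes "recfn (Suc k) (\<lambda>ys. F (ys ! 0) (tl ys))"
  shows "recfn (Suc (Suc k)) (\<lambda>ys. F (ys ! 0) (tl (tl ys)))"
proof (rule recfn_cong)
  let ?F = "\<lambda>ys. F (ys ! 0) (tl ys)"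
  let ?gs = "(\<lambda>xs. xs ! 0) # map (\<lambda>i xs. xs ! Suc (Suc i)) [0..<k]"
  show "recfn (Suc (Suc k)) (\<lambda>xs. ?F (map (\<lambda>g. g xs) ?gs))"
    by (rule recfn_comp) (use assms in \<open>auto intro: recfn_nth\<close>)
  show "?F (map (\<lambda>g. g xs) ?gs) = F (xs ! 0) (tl (tl xs))" if "length xs = Suc (Suc k)" for xs
  proof -
    have "map (\<lambda>g. g xs) (map (\<lambda>i xs. xs ! Suc (Suc i)) [0..<k]) = tl (tl xs)"
      using that by (intro nth_equalityI) (auto simp: nth_tl)
    then show ?thesis by simp
  qed
qed

lemma recfn_sum:
  assumes "recfn k b" "recfn (Suc k) (\<lambda>ys. F (ys ! 0) (tl ys))"
  shows "recfn k (\<lambda>xs. \<Sum>i<b xs. F i xs)"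
proof -
  have "recfn k (\<lambda>xs. rec_nat 0 (\<lambda>y r. r + F y xs) (b xs))"
    by (intro recfn_rec_nat recfn_add recfn_nth recfn_zero recfn_drop_second assms) simp
  moreover have "rec_nat 0 (\<lambda>y r. r + F y xs) m = (\<Sum>i<m. F i xs)" for xs m
    by (induction m) auto
  ultimately show ?thesis by simp
qed

lemma recfn_mult:
  assumes "recfn k f" "recfn k g"
  shows "recfn k (\<lambda>xs. f xs * g xs)"
proof -
  have "recfn k (\<lambda>xs. \<Sum>i<f xs. g xs)"
    by (intro recfn_sum recfn_tl assms)
  then show ?thesis by simp
qed

lemma recfn_prod:
  assumes "recfn k b" "recfn (Suc k) (\<lambda>ys. F (ys ! 0) (tl ys))"
  shows "recfn k (\<lambda>xs. \<Prod>i<b xs. F i xs)"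
proof -
  have "recfn k (\<lambda>xs. rec_nat 1 (\<lambda>y r. r * F y xs) (b xs))"
    by (intro recfn_rec_nat recfn_mult recfn_nth recfn_const recfn_drop_second assms) simp
  moreover have "rec_nat 1 (\<lambda>y r. r * F y xs) m = (\<Prod>i<m. F i xs)" for xs m
    by (induction m) auto
  ultimately show ?thesis by simp
qed

lemma recfn_power:
  assumes "recfn k f" "recfn k g"
  shows "recfn k (\<lambda>xs. f xs ^ g xs)"
proof -
  have "recfn k (\<lambda>xs. \<Prod>i<g xs. f xs)"
    by (intro recfn_prod recfn_tl assms)
  then show ?thesis by simp
qed

lemma recfn_diff:
  assumes "recfn k f" "recfn k g"
  shows "recfn k (\<lambda>xs. f xs - g xs)"
proof -
  \<comment> \<open>Returning the counter instead of the accumulated value gives the predecessor,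
    whose iteration is truncated subtraction.\<close>
  have "recfn 1 (\<lambda>xs. rec_nat 0 (\<lambda>y r. y) (xs ! 0))"
    by (intro recfn_rec_nat recfn_nth recfn_zero) auto
  moreover have "rec_nat 0 (\<lambda>y r. y) m = m - 1" for m :: nat
    by (cases m) auto
  ultimately have pred: "recfn 1 (\<lambda>xs. xs ! 0 - 1)" by simp
  have "recfn k (\<lambda>xs. rec_nat (f xs) (\<lambda>y r. r - 1) (g xs))"
    by (intro recfn_rec_nat recfn_comp1[OF pred] recfn_nth assms) simp
  moreover have "rec_nat a (\<lambda>y r. r - 1) b = a - b" for a b :: nat
    by (induction b) auto
  ultimately show ?thesis by simp
qed

lemma recfn_if_zero:
  assumes "recfn k f" "recfn k g" "recfn k h"
  shows "recfn k (\<lambda>xs. if f xs = 0 then g xs else h xs)"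
proof -
  \<comment> \<open>\<open>1 - f xs\<close> is the indicator of \<open>f xs = 0\<close>; subtracting
    it from 1 again gives the indicator of the other case.\<close>
  have "recfn k (\<lambda>xs. (1 - f xs) * g xs + (1 - (1 - f xs)) * h xs)"
    by (intro recfn_add recfn_mult recfn_diff recfn_const assms)
  moreover have "(1 - a) * b + (1 - (1 - a)) * c = (if a = 0 then b else c)" for a b c :: nat
    by (cases a) simp_all
  ultimately show ?thesis by (simp only:)
qed

text \<open>The quotient counts the positive multiples of \<open>b\<close> that are at most
  \<open>a\<close>; they are all of the form \<open>Suc i * b\<close> with \<open>i < a\<close>.
  Truncated subtraction turns the comparison into a test for zero.\<close>

lemma div_eq_sum:
  fixes a b :: nat
  assumes "b > 0"
  shows "a div b = (\<Sum>i<a. if Suc i * b - a = 0 then 1 else 0)"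
proof -
  have "Suc i * b - a = 0 \<longleftrightarrow> i < a div b" for i
    using less_eq_div_iff_mult_less_eq[OF assms, of "Suc i" a] by (simp only: diff_is_0_eq Suc_le_eq)
  then have "(\<Sum>i<a. if Suc i * b - a = 0 then 1 else 0 :: nat) = (\<Sum>i<a. if i < a div b then 1 else 0)"
    by (simp only:)
  also have "\<dots> = card ({..<a} \<inter> {i. i < a div b})"
    by (subst sum.If_cases) auto
  also have "{..<a} \<inter> {i. i < a div b} = {..<a div b}"
    using div_le_dividend[of a b] by (auto intro: less_le_trans)
  finally show ?thesis by simp
qed

lemma recfn_div:
  assumes "recfn k f" "recfn k g"
  shows "recfn k (\<lambda>xs. f xs div g xs)"
proof -
  \<comment> \<open>For a zero divisor the sum would be the dividend, while
    \<open>a div 0 = 0\<close>.\<close>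
  have "recfn k (\<lambda>xs. if g xs = 0 then 0 else (\<Sum>i<f xs. if Suc i * g xs - f xs = 0 then 1 else 0))"
    by (intro recfn_if_zero recfn_sum recfn_diff recfn_mult recfn_Suc recfn_zero recfn_const recfn_nth
        assms assms[THEN recfn_tl]) simp
  moreover have "(if b = 0 then 0 else (\<Sum>i<a. if Suc i * b - a = 0 then 1 else 0)) = a div b" for a b :: nat
    using div_eq_sum[of b a] by (cases "b = 0") simp_all
  ultimately show ?thesis by simp
qed

lemma recfn_mod:
  assumes "recfn k f" "recfn k g"
  shows "recfn k (\<lambda>xs. f xs mod g xs)"
proof -
  have "recfn k (\<lambda>xs. f xs - f xs div g xs * g xs)"
    by (intro recfn_diff recfn_mult recfn_div assms)
  then show ?thesis by (simp add: minus_div_mult_eq_mod)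
qed

lemmas recfn_intros = recfn_nth recfn_nth_tl recfn_nth_tl2 recfn_const recfn_Suc
  recfn_add recfn_diff recfn_mult recfn_div recfn_mod recfn_power recfn_if_zero
  recfn_sum recfn_prod recfn_rec_nat

text \<open>Decoding by exhaustive search: both components are at most the code, so a double sum
  over this range meets the encoded pair exactly once. The argument \<open>p\<close> of
  \<open>h\<close> selects the component.\<close>

lemma recfn_prod_decode:
  assumes "recfn k f"
  shows "recfn k (\<lambda>xs. fst (prod_decode (f xs)))" "recfn k (\<lambda>xs. snd (prod_decode (f xs)))"
proof -
  define e where "e m n c = prod_encode (m, n) - c + (c - prod_encode (m, n))" for m n c
  define h where "h p c = (\<Sum>m<Suc c. \<Sum>n<Suc c. if e m n c = 0 then p m n else 0)"
    for p :: "nat \<Rightarrow> nat \<Rightarrow> nat" and c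
  have h: "h p c = p (fst (prod_decode c)) (snd (prod_decode c))" for p c
  proof -
    obtain m n where mn: "prod_decode c = (m, n)" by fastforce
    then have c: "c = prod_encode (m, n)" by (metis prod_decode_inverse)
    have e0: "e a b c = 0 \<longleftrightarrow> a = m \<and> b = n" for a b
      using prod_encode_eq[of "(a, b)" "(m, n)"] unfolding e_def c by auto
    have "h p c = (\<Sum>z\<in>{..<Suc c} \<times> {..<Suc c}. if z = (m, n) then p m n else 0)"
      unfolding h_def sum.cartesian_product by (intro sum.cong) (auto simp: e0 split: if_splits)
    also have "\<dots> = p m n"
      using le_prod_encode_1[of m n] le_prod_encode_2[of n m] by (simp add: c less_Suc_eq_le)
    finally show ?thesis by (simp add: mn)
  qed
  have e: "recfn 3 (\<lambda>xs. e (xs ! 0) (xs ! 1) (xs ! 2))"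
    unfolding e_def prod_encode_def triangle_def prod.case by (intro recfn_intros) auto
  have "recfn 1 (\<lambda>xs. h (\<lambda>m n. m) (xs ! 0))" "recfn 1 (\<lambda>xs. h (\<lambda>m n. n) (xs ! 0))"
    unfolding h_def by (intro recfn_intros recfn_comp3[OF e]; simp)+
  then show "recfn k (\<lambda>xs. fst (prod_decode (f xs)))" "recfn k (\<lambda>xs. snd (prod_decode (f xs)))"
    unfolding h by (auto intro: recfn_comp1[OF _ assms])
qed

text \<open>A nonempty list is coded as \<open>Suc (prod_encode (x, list_encode xs))\<close>, so
  subtracting one and taking the second component removes the head.\<close>

definition code_nth :: "nat \<Rightarrow> nat \<Rightarrow> nat" where
  "code_nth c j = fst (prod_decode (rec_nat c (\<lambda>_ r. snd (prod_decode (r - 1))) j - 1))"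

lemma code_nth_list_encode:
  assumes "j < length xs"
  shows "code_nth (list_encode xs) j = xs ! j"
proof -
  have "rec_nat (list_encode xs) (\<lambda>_ r. snd (prod_decode (r - 1))) j = list_encode (drop j xs)"
    using assms
  proof (induction j)
    case (Suc j)
    then show ?case using Cons_nth_drop_Suc[of j xs, symmetric] by simp
  qed simp
  then show ?thesis
    using assms Cons_nth_drop_Suc[of j xs, symmetric] by (simp add: code_nth_def)
qed

lemma recfn_code_nth:
  assumes "recfn k f" "recfn k g"
  shows "recfn k (\<lambda>xs. code_nth (f xs) (g xs))"
  unfolding code_nth_def by (intro recfn_prod_decode recfn_intros assms) auto

section \<open>Linear dependence and periodicity\<close>

text \<open>Gaussian elimination without division: a vector with a nonzero entry at \<open>x\<close>
  serves as pivot, and cross-multiplication removes this coordinate from the others. It therefore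
  works over the integers.\<close>

lemma exists_linear_dependence:
  fixes F :: "'j \<Rightarrow> 'i \<Rightarrow> 'r::idom"
  assumes "finite I" "finite J" "card I < card J"
  shows "\<exists>\<beta>. (\<exists>j\<in>J. \<beta> j \<noteq> 0) \<and> (\<forall>x\<in>I. (\<Sum>j\<in>J. \<beta> j * F j x) = 0)"
  using assms
proof (induction I arbitrary: J F rule: finite_induct)
  case empty
  then have "J \<noteq> {}" by auto
  then show ?case by (intro exI[of _ "\<lambda>_. 1"]) auto
next
  case (insert x I)
  show ?case
  proof (cases "\<forall>j\<in>J. F j x = 0")
    case True
    obtain \<beta> where "\<exists>j\<in>J. \<beta> j \<noteq> 0" "\<forall>x\<in>I. (\<Sum>j\<in>J. \<beta> j * F j x) = 0"
      using insert.IH[of J F] insert.prems insert.hyps by auto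
    with True show ?thesis by (intro exI[of _ \<beta>]) auto
  next
    case False
    then obtain j0 where j0: "j0 \<in> J" "F j0 x \<noteq> 0" by blast
    let ?J = "J - {j0}"
    let ?G = "\<lambda>j y. F j0 x * F j y - F j x * F j0 y"
    have "card I < card ?J" using insert.prems insert.hyps j0 by (simp add: card_Diff_singleton)
    then obtain \<beta> where \<beta>: "\<exists>j\<in>?J. \<beta> j \<noteq> 0" "\<forall>y\<in>I. (\<Sum>j\<in>?J. \<beta> j * ?G j y) = 0"
      using insert.IH[of ?J ?G] insert.prems by auto
    \<comment> \<open>Combining the eliminated vectors with \<open>\<beta>\<close> amounts to
      combining the original ones with \<open>\<gamma>\<close>. A nonzero \<open>\<beta> j\<close>
      stays nonzero when multiplied by the pivot entry.\<close>
    define \<gamma> where "\<gamma> j = (if j = j0 then - (\<Sum>j\<in>?J. \<beta> j * F j x) else \<beta> j * F j0 x)" for j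
    have sum_\<gamma>: "(\<Sum>j\<in>J. \<gamma> j * F j y) = (\<Sum>j\<in>?J. \<beta> j * ?G j y)" for y
    proof -
      have "(\<Sum>j\<in>J. \<gamma> j * F j y) = \<gamma> j0 * F j0 y + (\<Sum>j\<in>?J. \<gamma> j * F j y)"
        using insert.prems j0 by (simp add: sum.remove)
      also have "(\<Sum>j\<in>?J. \<gamma> j * F j y) = (\<Sum>j\<in>?J. \<beta> j * F j0 x * F j y)"
        by (intro sum.cong) (auto simp: \<gamma>_def)
      finally show ?thesis
        by (simp add: \<gamma>_def algebra_simps sum_subtractf sum_distrib_left sum_distrib_right)
    qed
    have "(\<Sum>j\<in>J. \<gamma> j * F j y) = 0" if "y \<in> insert x I" for y
      using that \<beta>(2) unfolding sum_\<gamma> by (auto simp: mult.commute)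
    moreover have "\<exists>j\<in>J. \<gamma> j \<noteq> 0" using \<beta>(1) j0 by (auto simp: \<gamma>_def)
    ultimately show ?thesis by blast
  qed
qed

text \<open>
  For a shortest word with nonzero value, a linear dependence among the vectors of its prefixes
  would express the value through those of shorter words.
\<close>

lemma zero_if_zero_on_short_words:
  fixes d :: "'a list \<Rightarrow> 'r::idom" and F :: "'a list \<Rightarrow> 'i \<Rightarrow> 'r"
  assumes "finite I"
    and fact: "\<And>v. \<exists>k. \<forall>w. d (w @ v) = (\<Sum>x\<in>I. k x * F w x)"
    and short: "\<And>w. length w \<le> card I \<Longrightarrow> d w = 0"
  shows "d w = 0"
proof (induction "length w" arbitrary: w rule: less_induct)
  case less
  show ?case
  proof (cases "length w \<le> card I")
    case True
    then show ?thesis by (rule short)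
  next
    case False
    let ?J = "{..card I}"
    obtain \<beta> where \<beta>: "\<exists>j\<in>?J. \<beta> j \<noteq> 0" "\<forall>x\<in>I. (\<Sum>j\<in>?J. \<beta> j * F (take j w) x) = 0"
      using exists_linear_dependence[OF \<open>finite I\<close>, of ?J "\<lambda>j. F (take j w)"] by auto
    \<comment> \<open>Cutting \<open>w\<close> at the last index with a nonzero coefficient makes
      all other contributing words \<open>take i w @ drop j w\<close> shorter than
      \<open>w\<close>.\<close>
    define j where "j = Max {j \<in> ?J. \<beta> j \<noteq> 0}"
    have "j \<in> {j \<in> ?J. \<beta> j \<noteq> 0}" unfolding j_def using \<beta>(1) by (intro Max_in) auto
    then have j: "j \<le> card I" "\<beta> j \<noteq> 0" by auto
    have above: "\<beta> i = 0" if "i \<le> card I" "j < i" for i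
    proof (rule ccontr)
      assume "\<beta> i \<noteq> 0"
      then have "i \<le> j" unfolding j_def using that by (intro Max_ge) auto
      then show False using that by simp
    qed
    define v where "v = drop j w"
    obtain k where k: "\<And>u. d (u @ v) = (\<Sum>x\<in>I. k x * F u x)" using fact by blast
    have below: "d (take i w @ v) = 0" if "i < j" for i
      using that j False by (intro less) (auto simp: v_def)
    have "0 = (\<Sum>x\<in>I. k x * (\<Sum>i\<in>?J. \<beta> i * F (take i w) x))" using \<beta>(2) by simp
    also have "\<dots> = (\<Sum>i\<in>?J. \<beta> i * d (take i w @ v))"
      unfolding k sum_distrib_left by (subst sum.swap) (simp add: mult_ac)
    also have "\<dots> = (\<Sum>i\<in>?J. if i = j then \<beta> i * d (take i w @ v) else 0)"
    proof (intro sum.cong refl)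
      fix i assume "i \<in> ?J"
      then show "\<beta> i * d (take i w @ v) = (if i = j then \<beta> i * d (take i w @ v) else 0)"
        using above[of i] below[of i] by (cases i j rule: linorder_cases) auto
    qed
    also have "\<dots> = \<beta> j * d w" using j by (simp add: v_def)
    finally show ?thesis using j by simp
  qed
qed

text \<open>One copy of the coordinates \<open>I\<close> for each class, with \<open>F w\<close> in
  the copy of \<open>cls w\<close> and zeros elsewhere, turns coefficients depending on the class of
  \<open>w\<close> into coefficients independent of \<open>w\<close>. The dimension becomes
  \<open>card Q * card I\<close>.\<close>

lemma zero_if_zero_on_short_words_classes:
  fixes d :: "'a list \<Rightarrow> 'r::idom" and F :: "'a list \<Rightarrow> 'i \<Rightarrow> 'r" and cls :: "'a list \<Rightarrow> 'q"
  assumes "finite I" "finite Q" "\<And>w. cls w \<in> Q"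
    and fact: "\<And>v. \<exists>k. \<forall>w. d (w @ v) = (\<Sum>x\<in>I. k (cls w) x * F w x)"
    and short: "\<And>w. length w \<le> card Q * card I \<Longrightarrow> d w = 0"
  shows "d w = 0"
proof (rule zero_if_zero_on_short_words[where I = "Q \<times> I" and
      F = "\<lambda>w (q, x). if cls w = q then F w x else 0"])
  show "finite (Q \<times> I)" using assms by simp
  show "d w = 0" if "length w \<le> card (Q \<times> I)" for w
    using that short by (simp add: card_cartesian_product)
  fix v
  obtain k where k: "\<And>w. d (w @ v) = (\<Sum>x\<in>I. k (cls w) x * F w x)" using fact by blast
  have "d (w @ v) = (\<Sum>p\<in>Q \<times> I. (case p of (q, x) \<Rightarrow> k q x) * (case p of (q, x) \<Rightarrow> if cls w = q then F w x else 0))"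
    for w
  proof -
    have "(\<Sum>p\<in>Q \<times> I. (case p of (q, x) \<Rightarrow> k q x) * (case p of (q, x) \<Rightarrow> if cls w = q then F w x else 0))
      = (\<Sum>q\<in>Q. \<Sum>x\<in>I. k q x * (if cls w = q then F w x else 0))"
      by (simp add: sum.cartesian_product case_prod_beta)
    also have "\<dots> = (\<Sum>q\<in>Q. if cls w = q then (\<Sum>x\<in>I. k q x * F w x) else 0)"
      by (intro sum.cong) auto
    also have "\<dots> = (\<Sum>x\<in>I. k (cls w) x * F w x)" using assms by simp
    finally show ?thesis using k by simp
  qed
  then show "\<exists>k. \<forall>w. d (w @ v) = (\<Sum>p\<in>Q \<times> I. k p * (case p of (q, x) \<Rightarrow> if cls w = q then F w x else 0))"
    by (intro exI[of _ "\<lambda>(q, x). k q x"]) auto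
qed

text \<open>An orbit in at most \<open>M\<close> states has a repetition among its first
  \<open>M + 1\<close> members, so from time \<open>M\<close> on it is periodic with period at most
  \<open>M\<close>. The window of length \<open>M\<close> starting there shows every state that
  recurs.\<close>

lemma infinite_hits_iff:
  fixes S :: "nat \<Rightarrow> 'q"
  assumes step: "\<And>l. S (Suc l) = g (S l)" and "finite Q" "\<And>l. S l \<in> Q" "card Q \<le> M"
  shows "infinite {l. P (S l)} \<longleftrightarrow> (\<exists>l<M. P (S (M + l)))"
proof -
  have "\<not> inj_on S {..M}"
  proof
    assume "inj_on S {..M}"
    then have "card {..M} \<le> card Q" using assms by (intro card_inj_on_le[of S]) auto
    then show False using assms by simp
  qed
  then obtain i0 j0 where ij0: "i0 \<le> M" "j0 \<le> M" "i0 \<noteq> j0" "S i0 = S j0"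
    unfolding inj_on_def by auto
  define i j where "i = min i0 j0" and "j = max i0 j0"
  have ij: "i < j" "j \<le> M" "S i = S j"
    using ij0 by (auto simp: i_def j_def min_def max_def)
  define per where "per = j - i"
  have "S (i + t + per) = S (i + t)" for t
  proof (induction t)
    case 0
    then show ?case using ij by (simp add: per_def)
  next
    case (Suc t)
    then show ?case by (simp add: step)
  qed
  then have per: "S (l + per) = S l" if "i \<le> l" for l
    using that by (metis le_add_diff_inverse)
  have "per > 0" "per \<le> M" using ij by (auto simp: per_def)
  show ?thesis
  proof
    assume "infinite {l. P (S l)}"
    then have ex: "\<exists>l. M \<le> l \<and> P (S l)" unfolding infinite_nat_iff_unbounded_le by auto
    \<comment> \<open>The first hit from \<open>M\<close> on lies in the window: otherwise going
      back one period would give an earlier one.\<close>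
    define l where "l = (LEAST l. M \<le> l \<and> P (S l))"
    have l: "M \<le> l" "P (S l)" using LeastI_ex[OF ex] by (auto simp: l_def)
    have "l < M + M"
    proof (rule ccontr)
      assume "\<not> l < M + M"
      then have "M \<le> l - per" "l - per < l" using \<open>per > 0\<close> \<open>per \<le> M\<close> l by auto
      moreover from this have "S (l - per) = S l" using per[of "l - per"] ij \<open>per \<le> M\<close> l by simp
      ultimately show False using not_less_Least[of "l - per" "\<lambda>l. M \<le> l \<and> P (S l)"] l
        by (auto simp: l_def)
    qed
    then show "\<exists>l<M. P (S (M + l))" using l by (intro exI[of _ "l - M"]) auto
  next
    assume "\<exists>l<M. P (S (M + l))"
    then obtain l where l: "P (S (M + l))" by blast
    have "S (M + l + t * per) = S (M + l)" for t
    proof (induction t)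
      case (Suc t)
      then show ?case using per[of "M + l + t * per"] ij by (simp add: algebra_simps)
    qed simp
    then have "\<exists>m'\<ge>m. P (S m')" for m
      using l \<open>per > 0\<close> by (intro exI[of _ "M + l + m * per"]) (auto intro: trans_le_add2)
    then show "infinite {l. P (S l)}" unfolding infinite_nat_iff_unbounded_le by auto
  qed
qed

section \<open>Words of a given length as numbers\<close>

definition letter :: "nat \<Rightarrow> 'a::{finite,linorder}" where
  "letter i = sorted_list_of_set UNIV ! i"

lemma letter_less:
  assumes "i < j" "j < CARD('a::{finite,linorder})"
  shows "(letter i :: 'a) < letter j"
  unfolding letter_def
  using assms sorted_wrt_nth_less[OF strict_sorted_list_of_set[of "UNIV :: 'a set"], of i j] by simp

text \<open>The letters are the digits of \<open>x\<close> in base \<open>CARD('a)\<close>, most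
  significant first. Digits from position \<open>l\<close> on are ignored, so \<open>x\<close> may
  be arbitrarily large.\<close>

primrec word :: "nat \<Rightarrow> nat \<Rightarrow> 'a::{finite,linorder} list" where
  "word 0 x = []"
| "word (Suc l) x = letter (x div CARD('a) ^ l mod CARD('a)) # word l x"

lemma length_word [simp]: "length (word l x) = l"
  by (induction l) auto

lemma word_cong:
  "x mod CARD('a) ^ l = y mod CARD('a) ^ l \<Longrightarrow> (word l x :: 'a::{finite,linorder} list) = word l y"
proof (induction l)
  case (Suc l)
  let ?k = "CARD('a)"
  have digits: "z div ?k ^ l mod ?k = (z mod ?k ^ Suc l) div ?k ^ l" "z mod ?k ^ l = (z mod ?k ^ Suc l) mod ?k ^ l" for z
    by (simp_all add: mod_mult2_eq mult.commute[of ?k])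
  have "(word l x :: 'a list) = word l y"
    by (rule Suc.IH) (simp only: digits(2)[of x] digits(2)[of y] Suc.prems)
  then show ?case by (simp only: word.simps digits(1)[of x] digits(1)[of y] Suc.prems)
qed simp

text \<open>The most significant digit comes first, so leading digits decide unless they agree, in
  which case the remainders modulo \<open>CARD('a) ^ l\<close> are compared.\<close>

lemma word_lex:
  assumes "x < y" "y < CARD('a) ^ l"
  shows "(word l x :: 'a::{finite,linorder} list, word l y) \<in> lex {(a, b). a < b}"
  using assms
proof (induction l arbitrary: x y)
  case (Suc l)
  let ?k = "CARD('a)"
  have k: "?k ^ l > 0" by simp
  have digit: "z div ?k ^ l mod ?k = z div ?k ^ l" if "z < ?k ^ Suc l" for z
    using that by (intro mod_less less_mult_imp_div_less) simp
  have y: "y div ?k ^ l < ?k" using Suc.prems by (intro less_mult_imp_div_less) simp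
  have le: "x div ?k ^ l \<le> y div ?k ^ l" using Suc.prems by (intro div_le_mono) simp
  show ?case
  proof (cases "x div ?k ^ l = y div ?k ^ l")
    case True
    have "x mod ?k ^ l < y mod ?k ^ l"
      using Suc.prems True by (metis add_less_cancel_left div_mult_mod_eq)
    then have "(word l (x mod ?k ^ l) :: 'a list, word l (y mod ?k ^ l)) \<in> lex {(a, b). a < b}"
      using k by (intro Suc.IH) simp_all
    moreover have "(word l (z mod ?k ^ l) :: 'a list) = word l z" for z
      by (rule word_cong) simp
    ultimately show ?thesis using True by simp
  next
    case False
    then show ?thesis using le y Suc.prems letter_less[of "x div ?k ^ l" "y div ?k ^ l", where 'a = 'a]
      by (simp add: digit)
  qed
qed simp

text \<open>For equal lengths, one direction is \<open>word_lex\<close>; the other follows from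
  irreflexivity and asymmetry of the lexicographic order.\<close>

lemma word_radix_iff:
  assumes "x < CARD('a) ^ l" "y < CARD('a) ^ m"
  shows "(word l x :: 'a::{finite,linorder} list, word m y) \<in> radix \<longleftrightarrow> l < m \<or> l = m \<and> x < y"
proof -
  have "irrefl {(a :: 'a, b). a < b}" "asym {(a :: 'a, b). a < b}"
    by (auto simp: irrefl_def intro: asymI)
  then have irr: "(w, w) \<notin> lex {(a, b). a < b}"
    and asym: "(v, w) \<in> lex {(a, b). a < b} \<Longrightarrow> (w, v) \<notin> lex {(a, b). a < b}" for v w :: "'a list"
    by (auto dest: asymD[OF asym_lex])
  show ?thesis
    using assms word_lex[of x y l, where 'a = 'a] word_lex[of y x l, where 'a = 'a]
      irr[of "word l x"] asym[of "word l x" "word l y"]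
    by (cases x y rule: linorder_cases) (auto simp: radix_def lenlex_conv)
qed

text \<open>Distinct numbers give words that are strictly comparable in the radix order, hence
  distinct; surjectivity follows by counting.\<close>

lemma bij_betw_word:
  "bij_betw (word l) {..<CARD('a) ^ l} {w :: 'a::{finite,linorder} list. length w = l}"
proof -
  have "inj_on (word l :: nat \<Rightarrow> 'a list) {..<CARD('a) ^ l}"
  proof (rule inj_onI)
    fix x y assume *: "x \<in> {..<CARD('a) ^ l}" "y \<in> {..<CARD('a) ^ l}" "(word l x :: 'a list) = word l y"
    have "\<not> x < y" "\<not> y < x"
      using * word_radix_iff[of x l y l, where 'a = 'a] word_radix_iff[of y l x l, where 'a = 'a]
        word_radix_iff[of x l x l, where 'a = 'a] by auto
    then show "x = y" by simp
  qed
  moreover have "word l ` {..<CARD('a) ^ l} = {w :: 'a list. length w = l}"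
  proof (rule card_subset_eq)
    have "finite {w :: 'a list. set w \<subseteq> UNIV \<and> length w = l}" by (rule finite_lists_length_eq) simp
    then show "finite {w :: 'a list. length w = l}" by simp
    show "card (word l ` {..<CARD('a) ^ l} :: 'a list set) = card {w :: 'a list. length w = l}"
      using card_lists_length_eq[of "UNIV :: 'a set" l] calculation by (simp add: card_image)
  qed auto
  ultimately show ?thesis by (simp add: bij_betw_def)
qed

lemma obtain_word:
  fixes w :: "'a::{finite,linorder} list"
  obtains x where "x < CARD('a) ^ length w" "w = word (length w) x"
  using bij_betw_word[of "length w", where 'a = 'a] by (auto simp: bij_betw_def image_iff set_eq_iff)

text \<open>Identifying words with pairs of a length and a number turns the rank into bounded sums,
  a form that can be computed.\<close>

lemma val_word:
  assumes "x < CARD('a) ^ l"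
  shows "val L (word l x :: 'a::{finite,linorder} list) =
    (\<Sum>m<l. \<Sum>y<CARD('a) ^ m. if (word m y :: 'a list) \<in> L then 1 else 0)
      + (\<Sum>y<x. if (word l y :: 'a list) \<in> L then 1 else 0)"
proof -
  let ?w = "\<lambda>(m, y). word m y :: 'a list"
  let ?A = "SIGMA m:{..<l}. {y \<in> {..<CARD('a) ^ m}. (word m y :: 'a list) \<in> L}"
  let ?B = "{l} \<times> {y \<in> {..<x}. (word l y :: 'a list) \<in> L}"
  have "{u \<in> L. (u, word l x) \<in> radix} = ?w ` (?A \<union> ?B)"
  proof safe
    fix u assume u: "u \<in> L" "(u, word l x :: 'a list) \<in> radix"
    obtain y where y: "y < CARD('a) ^ length u" "u = word (length u) y" by (rule obtain_word)
    then have "length u < l \<or> length u = l \<and> y < x" using word_radix_iff[OF y(1) assms] u(2) by simp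
    then have "(length u, y) \<in> ?A \<union> ?B" using y u by auto
    moreover have "u = ?w (length u, y)" using y by simp
    ultimately show "u \<in> ?w ` (?A \<union> ?B)" by blast
  next
    fix m y assume "y < CARD('a) ^ m" "m < l"
    then show "(word m y :: 'a list, word l x) \<in> radix" using word_radix_iff[OF _ assms] by blast
  next
    fix y assume "y < x"
    then show "(word l y :: 'a list, word l x) \<in> radix" using assms word_radix_iff[OF _ assms, of y l] by simp
  qed
  moreover have "inj_on ?w (?A \<union> ?B)"
  proof (rule inj_onI, clarify)
    fix m y m' y' assume *: "(m, y) \<in> ?A \<union> ?B" "(m', y') \<in> ?A \<union> ?B" "(word m y :: 'a list) = word m' y'"
    then have m: "m = m'" by (metis length_word)
    have "y < CARD('a) ^ m" "y' < CARD('a) ^ m" using * m assms by auto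
    then show "m = m' \<and> y = y'" using * m bij_betw_word[of m, where 'a = 'a]
      by (auto simp: bij_betw_def inj_on_def)
  qed
  ultimately have "val L (word l x :: 'a list) = card (?A \<union> ?B)" by (simp add: val_def card_image)
  also have "\<dots> = card ?A + card ?B" by (rule card_Un_disjoint) auto
  also have "card ?A = (\<Sum>m<l. card {y \<in> {..<CARD('a) ^ m}. (word m y :: 'a list) \<in> L})" by simp
  also have "card ?B = card {y \<in> {..<x}. (word l y :: 'a list) \<in> L}"
    by (rule card_cartesian_product_singleton)
  moreover have "card {y \<in> {..<m}. P y} = (\<Sum>y<m. if P y then 1 else 0)" for m :: nat and P
    by (simp only: card_eq_sum) (rule sum.inter_filter, simp)
  ultimately show ?thesis by (simp only:)
qed

section \<open>The rank of the enumerating series\<close>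

lemma finite_words: "finite {u :: 'a::finite list. length u = m}"
  "finite {u :: 'a::finite list. length u \<le> m}" "finite {u :: 'a::finite list. length u < m}"
proof -
  have "finite {u :: 'a list. set u \<subseteq> UNIV \<and> length u \<le> m}" by (rule finite_lists_length_le) simp
  then show *: "finite {u :: 'a list. length u \<le> m}" by simp
  show "finite {u :: 'a list. length u = m}" "finite {u :: 'a list. length u < m}"
    by (rule finite_subset[OF _ *], auto)+
qed

lemma lex_append_iff:
  assumes "length u = length w"
  shows "(u @ u', w @ v) \<in> lex r \<longleftrightarrow>
    (u, w) \<in> lex r \<and> length u' = length v \<or> u = w \<and> (u', v) \<in> lex r"
  using assms by (induction u w rule: list_induct2) (auto simp: Cons_in_lex)

text \<open>Serves to replace a sum over words, whose number grows with the length, by a sum over a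
  fixed finite set of classes.\<close>

lemma sum_group_classes:
  fixes A :: "'q \<Rightarrow> nat"
  assumes "finite U" "finite Q" "\<And>u. u \<in> U \<Longrightarrow> cls u \<in> Q"
  shows "(\<Sum>u\<in>U. A (cls u)) = (\<Sum>q\<in>Q. card {u \<in> U. cls u = q} * A q)"
proof -
  have "(\<Sum>u\<in>U. A (cls u)) = (\<Sum>q\<in>Q. \<Sum>u\<in>{u \<in> U. cls u = q}. A (cls u))"
    using assms by (intro sum.group[symmetric]) auto
  also have "\<dots> = (\<Sum>q\<in>Q. card {u \<in> U. cls u = q} * A q)"
    by (intro sum.cong) auto
  finally show ?thesis .
qed

text \<open>The words of \<open>L\<close> below \<open>w @ v\<close> that are not shorter than
  \<open>w\<close> are split as \<open>u @ u'\<close> with \<open>length u = length w\<close>. If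
  \<open>u\<close> precedes \<open>w\<close>, then \<open>u'\<close> may be as long as
  \<open>v\<close>; if \<open>u\<close> follows \<open>w\<close>, then \<open>u'\<close> must be
  shorter than \<open>v\<close>; if \<open>u = w\<close>, then \<open>u'\<close> must lie below
  \<open>v\<close>. In the sums over classes, the factors depending on \<open>w\<close> and those
  depending on \<open>v\<close> are separated.\<close>

lemma val_append:
  fixes L :: "'a::{finite,linorder} list set" and cls :: "'a list \<Rightarrow> 'q" and w v :: "'a list"
  defines "W \<equiv> {u. length u = length w}"
  defines "lt \<equiv> {u \<in> W. (u, w) \<in> lex {(a, b). a < b}}"
  defines "gt \<equiv> {u \<in> W. u \<noteq> w \<and> (u, w) \<notin> lex {(a, b). a < b}}"
  assumes Q: "finite Q" "\<And>w. cls w \<in> Q"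
    and acc: "\<And>w v. w @ v \<in> L \<longleftrightarrow> acc (cls w) v"
  shows "val L (w @ v) = card {u \<in> L. length u < length w}
    + (\<Sum>q\<in>Q. card {u \<in> lt. cls u = q} * card {v'. acc q v' \<and> length v' \<le> length v})
    + (\<Sum>q\<in>Q. card {u \<in> gt. cls u = q} * card {v'. acc q v' \<and> length v' < length v})
    + card {v'. acc (cls w) v' \<and> (v', v) \<in> radix}"
proof -
  define H where "H u = {u'. acc (cls u) u' \<and> (u @ u', w @ v) \<in> radix}" for u
  have radix: "(u @ u', w @ v) \<in> radix \<longleftrightarrow> length u' < length v \<or> length u' = length v \<and>
      ((u, w) \<in> lex {(a, b). a < b} \<or> u = w \<and> (u', v) \<in> lex {(a, b). a < b})" if "u \<in> W" for u u'
    using that by (auto simp: W_def radix_def lenlex_conv lex_append_iff)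
  have lt: "H u = {v'. acc (cls u) v' \<and> length v' \<le> length v}" if "u \<in> lt" for u
    using that by (auto simp: H_def lt_def radix)
  have gt: "H u = {v'. acc (cls u) v' \<and> length v' < length v}" if "u \<in> gt" for u
    using that by (auto simp: H_def gt_def radix)
  have irr: "irrefl {(a :: 'a, b). a < b}" by (auto simp: irrefl_def)
  have "w \<in> W" by (simp add: W_def)
  have "(w @ v', w @ v) \<in> radix \<longleftrightarrow> (v', v) \<in> radix" for v'
    using irr unfolding radix[OF \<open>w \<in> W\<close>] by (simp add: radix_def lenlex_conv)
  then have eq: "H w = {v'. acc (cls w) v' \<and> (v', v) \<in> radix}"
    by (simp only: H_def)
  have finW: "finite W" using finite_words by (simp add: W_def)
  have finH: "finite (H u)" if "u \<in> W" for u
    by (rule finite_subset[OF _ finite_words(2)[of "length v"]]) (use that in \<open>auto simp: H_def radix\<close>)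
  have W: "W = lt \<union> gt \<union> {w}" using \<open>w \<in> W\<close> by (auto simp: lt_def gt_def)
  have disj: "lt \<inter> gt = {}" "(lt \<union> gt) \<inter> {w} = {}" using irr by (auto simp: lt_def gt_def)
  have fin: "finite lt" "finite gt" using finW by (auto simp: lt_def gt_def)
  have "{u \<in> L. (u, w @ v) \<in> radix} = {u \<in> L. length u < length w} \<union> (\<lambda>(u, u'). u @ u') ` Sigma W H"
  proof safe
    fix u assume u: "u \<in> L" "(u, w @ v) \<in> radix" "u \<notin> (\<lambda>(u, u'). u @ u') ` Sigma W H"
    show "length u < length w"
    proof (rule ccontr)
      assume "\<not> length u < length w"
      then have "take (length w) u \<in> W" by (simp add: W_def)
      then have "(take (length w) u, drop (length w) u) \<in> Sigma W H"
        using u(1,2) acc[of "take (length w) u" "drop (length w) u"] by (simp add: H_def)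
      then have "take (length w) u @ drop (length w) u \<in> (\<lambda>(u, u'). u @ u') ` Sigma W H"
        by (intro image_eqI[where x = "(take (length w) u, drop (length w) u)"]) simp_all
      then show False using u(3) by simp
    qed
  next
    fix u :: "'a list" assume "length u < length w"
    then show "(u, w @ v) \<in> radix" by (simp add: radix_def lenlex_conv)
  next
    fix u u' assume "u \<in> W" "u' \<in> H u"
    then show "u @ u' \<in> L" "(u @ u', w @ v) \<in> radix" using acc[of u u'] by (simp_all add: H_def)
  qed
  moreover have "finite {u \<in> L. length u < length w}"
    by (rule finite_subset[OF _ finite_words(3)[of "length w"]]) auto
  moreover have "finite ((\<lambda>(u, u'). u @ u') ` Sigma W H)"
    using finW finH by (intro finite_imageI finite_SigmaI)
  moreover have "{u \<in> L. length u < length w} \<inter> (\<lambda>(u, u'). u @ u') ` Sigma W H = {}"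
    by (auto simp: W_def)
  ultimately have "val L (w @ v) =
      card {u \<in> L. length u < length w} + card ((\<lambda>(u, u'). u @ u') ` Sigma W H)"
    unfolding val_def by (simp only: card_Un_disjoint)
  also have "card ((\<lambda>(u, u'). u @ u') ` Sigma W H) = card (Sigma W H)"
    by (intro card_image) (auto simp: inj_on_def W_def)
  also have "\<dots> = (\<Sum>u\<in>W. card (H u))" using finW finH by simp
  also have "\<dots> = (\<Sum>u\<in>lt. card (H u)) + (\<Sum>u\<in>gt. card (H u)) + card (H w)"
    unfolding W using disj fin by (simp add: sum.union_disjoint)
  finally have "val L (w @ v) = card {u \<in> L. length u < length w}
    + (\<Sum>u\<in>lt. card (H u)) + (\<Sum>u\<in>gt. card (H u)) + card (H w)"
    by simp
  moreover have "(\<Sum>u\<in>lt. card (H u)) = (\<Sum>u\<in>lt. card {v'. acc (cls u) v' \<and> length v' \<le> length v})"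
    using lt by (intro sum.cong) auto
  moreover have "\<dots> = (\<Sum>q\<in>Q. card {u \<in> lt. cls u = q} * card {v'. acc q v' \<and> length v' \<le> length v})"
    using fin Q by (intro sum_group_classes)
  moreover have "(\<Sum>u\<in>gt. card (H u)) = (\<Sum>u\<in>gt. card {v'. acc (cls u) v' \<and> length v' < length v})"
    using gt by (intro sum.cong) auto
  moreover have "\<dots> = (\<Sum>q\<in>Q. card {u \<in> gt. cls u = q} * card {v'. acc q v' \<and> length v' < length v})"
    using fin Q by (intro sum_group_classes)
  ultimately show ?thesis by (simp only: eq)
qed

text \<open>By \<open>val_append\<close>, the difference at \<open>w @ v\<close>, taken over the
  integers, is a linear form in \<open>n\<close> row entries and \<open>2 * (card Q + 1)\<close>
  further numbers depending on \<open>w\<close> only, with coefficients given by \<open>v\<close>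
  and the class of \<open>w\<close>. The classes contribute the factor \<open>card Q\<close> of the
  bound.\<close>

lemma eq_enumerating_series_if_eq_on_short_words:
  fixes s :: "'a::{finite,linorder} list \<Rightarrow> nat" and cls :: "'a list \<Rightarrow> 'q"
    and row col :: "'a list \<Rightarrow> nat \<Rightarrow> nat"
  defines "L \<equiv> {w. s w \<noteq> 0}"
  assumes Q: "finite Q" "\<And>w. cls w \<in> Q"
    and acc: "\<And>w v. w @ v \<in> L \<longleftrightarrow> acc (cls w) v"
    and fact: "\<And>w v. s (w @ v) = (\<Sum>i<n. row w i * col v i)"
    and short: "\<And>w. length w \<le> card Q * (n + 2 * (card Q + 1)) \<Longrightarrow> s w = enumerating_series L w"
  shows "s w = enumerating_series L w"
proof -
  define d where "d w = int (s w) - int (enumerating_series L w)" for w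
  define lt where "lt w = {u. length u = length w \<and> (u, w) \<in> lex {(a :: 'a, b). a < b}}" for w
  define gt where "gt w = {u. length u = length w \<and> u \<noteq> w \<and> (u, w) \<notin> lex {(a :: 'a, b). a < b}}" for w
  \<comment> \<open>\<open>None\<close> stands for the constant 1 and the number of shorter words,
    \<open>Some q\<close> for the numbers of words of class \<open>q\<close> that have the length of
    \<open>w\<close> and precede or follow it.\<close>
  define J where "J = (UNIV :: bool set) \<times> insert None (Some ` Q)"
  define F where "F w x = int (case x of Inl i \<Rightarrow> row w i
      | Inr (True, None) \<Rightarrow> 1
      | Inr (False, None) \<Rightarrow> card {u \<in> L. length u < length w}
      | Inr (True, Some q) \<Rightarrow> card {u \<in> lt w. cls u = q}
      | Inr (False, Some q) \<Rightarrow> card {u \<in> gt w. cls u = q})" for w and x :: "nat + bool \<times> 'q option"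
  have "d w = 0"
  proof (rule zero_if_zero_on_short_words_classes[of "{..<n} <+> J" Q cls d F])
    show "finite ({..<n} <+> J)" using \<open>finite Q\<close> by (simp add: J_def)
    have "card J = 2 * (card Q + 1)"
      using \<open>finite Q\<close> by (simp add: J_def card_cartesian_product card_insert_if card_image)
    then have "card ({..<n} <+> J) = n + 2 * (card Q + 1)"
      using \<open>finite Q\<close> by (subst card_Plus) (simp_all add: J_def)
    then show "d w = 0" if "length w \<le> card Q * card ({..<n} <+> J)" for w
      using that short[of w] by (simp add: d_def)
    fix v
    \<comment> \<open>The coefficient of the constant coordinate absorbs the 1 that the enumerating
      series adds to the rank. Whether a rank is subtracted at all depends on \<open>w\<close> only
      through its class.\<close>
    define k where "k p x = (case x of Inl i \<Rightarrow> int (col v i)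
      | Inr (b, q) \<Rightarrow> if acc p v then - int (case (b, q) of
          (True, None) \<Rightarrow> 1 + card {v'. acc p v' \<and> (v', v) \<in> radix}
        | (False, None) \<Rightarrow> 1
        | (True, Some q) \<Rightarrow> card {v'. acc q v' \<and> length v' \<le> length v}
        | (False, Some q) \<Rightarrow> card {v'. acc q v' \<and> length v' < length v}) else 0)"
      for p and x :: "nat + bool \<times> 'q option"
    have "d (w @ v) = (\<Sum>x\<in>{..<n} <+> J. k (cls w) x * F w x)" for w
    proof -
      have "(\<Sum>x\<in>J. k (cls w) (Inr x) * F w (Inr x)) =
        (\<Sum>b\<in>UNIV. \<Sum>q\<in>insert None (Some ` Q). k (cls w) (Inr (b, q)) * F w (Inr (b, q)))"
        unfolding J_def by (simp add: sum.cartesian_product split_def del: sum.insert)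
      also have "\<dots> =
        (\<Sum>q\<in>insert None (Some ` Q). k (cls w) (Inr (True, q)) * F w (Inr (True, q)))
        + (\<Sum>q\<in>insert None (Some ` Q). k (cls w) (Inr (False, q)) * F w (Inr (False, q)))"
        unfolding UNIV_bool by (subst sum.insert) (simp_all add: add.commute del: sum.insert_if)
      also have "\<dots> = - int (enumerating_series L (w @ v))"
        using \<open>finite Q\<close> val_append[of Q cls L acc w v, OF assms(2,3) acc]
        by (simp add: sum.reindex k_def F_def enumerating_series_def acc lt_def gt_def
            sum_negf mult.commute)
      finally have "(\<Sum>x\<in>J. k (cls w) (Inr x) * F w (Inr x)) = - int (enumerating_series L (w @ v))" .
      moreover have "(\<Sum>i<n. k (cls w) (Inl i) * F w (Inl i)) = int (s (w @ v))"
        by (simp add: fact k_def F_def mult.commute)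
      moreover have "(\<Sum>x\<in>{..<n} <+> J. k (cls w) x * F w x) =
        (\<Sum>i<n. k (cls w) (Inl i) * F w (Inl i)) + (\<Sum>x\<in>J. k (cls w) (Inr x) * F w (Inr x))"
        using \<open>finite Q\<close> by (subst sum.Plus) (simp_all add: J_def)
      ultimately show ?thesis by (simp add: d_def)
    qed
    then show "\<exists>k. \<forall>w. d (w @ v) = (\<Sum>x\<in>{..<n} <+> J. k (cls w) x * F w x)" by blast
  qed (use assms in auto)
  then show ?thesis by (simp add: d_def)
qed

section \<open>Linear representations over the natural numbers and their supports\<close>

lemma mult_mat_vec_index_sum:
  assumes "A \<in> carrier_mat n m" "x \<in> carrier_vec m" "i < n"
  shows "(A *\<^sub>v x) $ i = (\<Sum>j<m. A $$ (i, j) * x $ j)"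
  using assms by (simp add: scalar_prod_def atLeast0LessThan)

text \<open>The value factors through the row vector \<lambda>\<mu>(w) and the column vector
  \<mu>(v)\<nu>, which bounds the Hankel rank of the series by \<open>rdim R\<close>.\<close>

lemma behaviour_append:
  assumes R: "nrepresentation R"
  shows "behaviour R (w @ v) =
    (\<Sum>i<rdim R. (\<Sum>j<rdim R. lam R $ j * mu_word R w $$ (j, i)) * (mu_word R v *\<^sub>v nu R) $ i)"
proof -
  let ?n = "rdim R" and ?c = "mu_word R v *\<^sub>v nu R"
  have W: "mu_word R w \<in> carrier_mat ?n ?n" and V: "mu_word R v \<in> carrier_mat ?n ?n"
    using R by (rule mu_word_carrier)+
  have nu: "nu R \<in> carrier_vec ?n" using R by (simp add: nrepresentation_def)
  have c: "?c \<in> carrier_vec ?n" using V nu by (rule mult_mat_vec_carrier)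
  have "behaviour R (w @ v) = lam R \<bullet> (mu_word R w *\<^sub>v ?c)"
    using R by (simp add: behaviour_def mu_word_append assoc_mult_mat_vec[OF W V nu])
  also have "\<dots> = (\<Sum>j<?n. lam R $ j * (\<Sum>i<?n. mu_word R w $$ (j, i) * ?c $ i))"
    using W c by (simp add: scalar_prod_def[of "lam R"] atLeast0LessThan mult_mat_vec_index_sum[OF W c]
        del: index_mult_mat_vec)
  also have "\<dots> = (\<Sum>i<?n. (\<Sum>j<?n. lam R $ j * mu_word R w $$ (j, i)) * ?c $ i)"
    unfolding sum_distrib_left sum_distrib_right by (subst sum.swap) (simp add: mult.assoc)
  finally show ?thesis .
qed

lemma behaviour_eq_sum:
  assumes R: "nrepresentation R"
  shows "behaviour R v = (\<Sum>i<rdim R. lam R $ i * (mu_word R v *\<^sub>v nu R) $ i)"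
proof -
  have "mu_word R v *\<^sub>v nu R \<in> carrier_vec (rdim R)"
    using mu_word_carrier[OF R, of v] R by (auto simp: nrepresentation_def)
  then show ?thesis
    unfolding behaviour_def scalar_prod_def[of "lam R"] atLeast0LessThan by (simp only: carrier_vecD)
qed

lemma mu_word_Nil_nu:
  assumes "nrepresentation R" "i < rdim R"
  shows "(mu_word R [] *\<^sub>v nu R) $ i = nu R $ i"
  using assms by (simp add: nrepresentation_def)

lemma mu_word_Cons_nu:
  assumes R: "nrepresentation R" and "i < rdim R"
  shows "(mu_word R (a # v) *\<^sub>v nu R) $ i =
    (\<Sum>j<rdim R. mu R a $$ (i, j) * (mu_word R v *\<^sub>v nu R) $ j)"
proof -
  let ?n = "rdim R" and ?c = "mu_word R v *\<^sub>v nu R"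
  have a: "mu R a \<in> carrier_mat ?n ?n" and nu: "nu R \<in> carrier_vec ?n"
    using R by (simp_all add: nrepresentation_def)
  have V: "mu_word R v \<in> carrier_mat ?n ?n" using R by (rule mu_word_carrier)
  have c: "?c \<in> carrier_vec ?n" using V nu by (rule mult_mat_vec_carrier)
  have "mu_word R (a # v) *\<^sub>v nu R = mu R a *\<^sub>v ?c"
    by (simp add: assoc_mult_mat_vec[OF a V nu])
  also have "\<dots> $ i = (\<Sum>j<?n. mu R a $$ (i, j) * ?c $ j)"
    using a c \<open>i < ?n\<close> by (rule mult_mat_vec_index_sum)
  finally show ?thesis .
qed

text \<open>\<open>S l\<close> is a subset of the coordinates, so that
  \<open>infinite_hits_iff\<close> applies with \<open>2 ^ rdim R\<close> states. Since each length
  has finitely many words, the support is infinite iff it contains words of infinitely many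
  lengths.\<close>

lemma infinite_support_iff:
  fixes R :: "'a::finite nrep"
  assumes R: "nrepresentation R" and M: "2 ^ rdim R \<le> M"
  shows "infinite {w. behaviour R w \<noteq> 0} \<longleftrightarrow> (\<exists>l<M. \<exists>w. length w = M + l \<and> behaviour R w \<noteq> 0)"
proof -
  let ?n = "rdim R" and ?c = "\<lambda>v. mu_word R v *\<^sub>v nu R"
  define S where "S l = {i. i < ?n \<and> (\<exists>v. length v = l \<and> ?c v $ i \<noteq> 0)}" for l
  define P where "P T \<longleftrightarrow> (\<exists>i\<in>T. lam R $ i \<noteq> 0)" for T
  have P: "P (S l) \<longleftrightarrow> (\<exists>w. length w = l \<and> behaviour R w \<noteq> 0)" for l
    by (auto simp: P_def S_def behaviour_eq_sum[OF R])
  \<comment> \<open>A sum of natural numbers is nonzero iff one of its terms is, so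
    \<open>S l\<close> alone determines \<open>S (Suc l)\<close>.\<close>
  have step: "S (Suc l) = {i. i < ?n \<and> (\<exists>j\<in>S l. \<exists>a. mu R a $$ (i, j) \<noteq> 0)}" for l
  proof -
    have "(\<exists>v. length v = Suc l \<and> ?c v $ i \<noteq> 0) \<longleftrightarrow> (\<exists>a v. length v = l \<and> ?c (a # v) $ i \<noteq> 0)" for i
      unfolding length_Suc_conv by blast
    moreover have "?c (a # v) $ i \<noteq> 0 \<longleftrightarrow> (\<exists>j<?n. mu R a $$ (i, j) \<noteq> 0 \<and> ?c v $ j \<noteq> 0)"
      if "i < ?n" for a v i
      unfolding mu_word_Cons_nu[OF R that] by (simp del: neq0_conv) blast
    ultimately show ?thesis unfolding S_def by blast
  qed
  have "infinite {l. P (S l)} \<longleftrightarrow> (\<exists>l<M. P (S (M + l)))"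
  proof (rule infinite_hits_iff[where Q = "Pow {..<?n}"])
    show "S (Suc l) = (\<lambda>T. {i. i < ?n \<and> (\<exists>j\<in>T. \<exists>a. mu R a $$ (i, j) \<noteq> 0)}) (S l)" for l
      by (rule step)
    show "S l \<in> Pow {..<?n}" for l by (auto simp: S_def)
  qed (use M in \<open>simp_all add: card_Pow\<close>)
  moreover have "infinite {l. P (S l)} \<longleftrightarrow> infinite {w. behaviour R w \<noteq> 0}"
  proof -
    have "{l. P (S l)} = length ` {w. behaviour R w \<noteq> 0}" by (auto simp: P)
    moreover have "finite {w. behaviour R w \<noteq> 0}" if "finite (length ` {w. behaviour R w \<noteq> 0})"
      by (rule finite_subset[OF _ finite_words(2)[of "Max (length ` {w. behaviour R w \<noteq> 0})"]])
        (use that in \<open>auto intro: Max_ge\<close>)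
    ultimately show ?thesis by auto
  qed
  ultimately show ?thesis by (simp only: P)
qed

text \<open>As nothing cancels in the natural numbers, whether \<open>w @ v\<close> is in the
  support depends on \<open>w\<close> only through the set of nonzero entries of \<lambda>\<mu>(w),
  which serves as the class of \<open>w\<close>. The length bound grows with the dimension, so any
  \<open>c\<close> above the dimension may be used.\<close>

lemma eq_enumerating_series_iff:
  fixes R :: "'a::{finite,linorder} nrep"
  assumes R: "nrepresentation R" and c: "rdim R \<le> c"
  defines "L \<equiv> {w. behaviour R w \<noteq> 0}"
  shows "behaviour R = enumerating_series L \<longleftrightarrow>
    (\<forall>w. length w \<le> 2 ^ c * (c + 2 * (2 ^ c + 1)) \<longrightarrow> behaviour R w = enumerating_series L w)"
    (is "?lhs \<longleftrightarrow> ?rhs")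
proof
  assume ?rhs
  define n where "n = rdim R"
  define col where "col v i = (mu_word R v *\<^sub>v nu R) $ i" for v i
  define row where "row w i = (\<Sum>j<n. lam R $ j * mu_word R w $$ (j, i))" for w i
  define cls where "cls w = {i. i < n \<and> row w i \<noteq> 0}" for w
  have fact: "behaviour R (w @ v) = (\<Sum>i<n. row w i * col v i)" for w v
    unfolding behaviour_append[OF R] by (simp add: row_def col_def n_def)
  have acc: "w @ v \<in> {w. behaviour R w \<noteq> 0} \<longleftrightarrow> (\<exists>i\<in>cls w. col v i \<noteq> 0)" for w v
    by (auto simp: fact cls_def simp del: neq0_conv)
  have "(2 :: nat) ^ n \<le> 2 ^ c" using c by (intro power_increasing) (auto simp: n_def)
  then have bound: "2 ^ n * (n + 2 * (2 ^ n + 1)) \<le> 2 ^ c * (c + 2 * (2 ^ c + 1))"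
    using c by (intro mult_le_mono add_le_mono) (auto simp: n_def)
  have "behaviour R w = enumerating_series {w. behaviour R w \<noteq> 0} w" for w
  proof (rule eq_enumerating_series_if_eq_on_short_words[where Q = "Pow {..<n}" and cls = cls
        and acc = "\<lambda>q v. \<exists>i\<in>q. col v i \<noteq> 0" and row = row and col = col and n = n])
    show "behaviour R w = enumerating_series {w. behaviour R w \<noteq> 0} w"
      if "length w \<le> card (Pow {..<n}) * (n + 2 * (card (Pow {..<n}) + 1))" for w
      using \<open>?rhs\<close> that bound by (simp add: card_Pow L_def)
    show "cls w \<in> Pow {..<n}" for w by (auto simp: cls_def)
  qed (simp, rule acc, rule fact)
  then show ?lhs unfolding L_def by (rule ext)
qed simp

text \<open>The added 1 makes \<open>enumerating_series L\<close> positive exactly on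
  \<open>L\<close>, so the only candidate for \<open>L\<close> is the support.\<close>

lemma ex_enumerating_series_iff:
  "(\<exists>L. is_ans L \<and> s = enumerating_series L) \<longleftrightarrow>
    infinite {w. s w \<noteq> 0} \<and> s = enumerating_series {w. s w \<noteq> 0}"
proof -
  have "{w. enumerating_series L w \<noteq> 0} = L" for L :: "'a list set"
    by (auto simp: enumerating_series_def)
  then show ?thesis unfolding is_ans_def by (intro iffI) (elim exE conjE, simp, blast)
qed

section \<open>The decision procedure\<close>

definition digit :: "nat \<Rightarrow> nat \<Rightarrow> nat \<Rightarrow> nat" where
  "digit n q j = q div n ^ j mod n"

lemma digit_add_low:
  assumes "j < l"
  shows "digit n (i * n ^ l + p) j = digit n p j"
proof (cases "n = 0")
  case False
  obtain m where l: "l = j + Suc m" using assms less_imp_add_positive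
    by (metis Suc_pred)
  have "(i * n ^ l + p) div n ^ j = (n ^ j * (n * (i * n ^ m)) + p) div n ^ j"
    by (simp add: l power_add mult_ac)
  also have "\<dots> = n * (i * n ^ m) + p div n ^ j" using False by simp
  finally show ?thesis by (simp add: digit_def)
qed (use assms in \<open>cases l; simp add: digit_def\<close>)

lemma digit_add_top:
  assumes "p < n ^ l" "i < n"
  shows "digit n (i * n ^ l + p) l = i"
  using assms by (simp add: digit_def)

lemma sum_lessThan_add:
  fixes g :: "nat \<Rightarrow> nat"
  shows "(\<Sum>q<a + b. g q) = (\<Sum>q<a. g q) + (\<Sum>p<b. g (a + p))"
  by (induction b) auto

lemma sum_lessThan_mult:
  fixes g :: "nat \<Rightarrow> nat"
  shows "(\<Sum>q<n * m. g q) = (\<Sum>i<n. \<Sum>p<m. g (i * m + p))"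
proof (induction n)
  case (Suc n)
  have "(\<Sum>q<Suc n * m. g q) = (\<Sum>q<n * m + m. g q)" by (simp add: add.commute)
  then show ?case using Suc by (simp only: sum_lessThan_add sum.lessThan_Suc)
qed simp

text \<open>The matrices are numbered from the right, in agreement with \<open>word\<close>, where
  the last letter is the digit at position 0.\<close>

primrec iterated_product :: "nat \<Rightarrow> (nat \<Rightarrow> nat \<Rightarrow> nat \<Rightarrow> nat) \<Rightarrow> (nat \<Rightarrow> nat) \<Rightarrow> nat \<Rightarrow> nat \<Rightarrow> nat" where
  "iterated_product n M v 0 i = v i"
| "iterated_product n M v (Suc l) i = (\<Sum>j<n. M l i j * iterated_product n M v l j)"

text \<open>
  A path through the states \<open>i\<^sub>l, \<dots>, i\<^sub>0\<close> is coded by the number with these digits in base \<open>n\<close>, so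
  that an entry of a matrix product becomes a single bounded sum, without any coding of vectors.
\<close>

definition path_weight :: "nat \<Rightarrow> (nat \<Rightarrow> nat \<Rightarrow> nat \<Rightarrow> nat) \<Rightarrow> (nat \<Rightarrow> nat) \<Rightarrow> nat \<Rightarrow> nat \<Rightarrow> nat" where
  "path_weight n M v l q = (\<Prod>j<l. M j (digit n q (Suc j)) (digit n q j)) * v (digit n q 0)"

text \<open>The digit \<open>i\<close> at position \<open>l\<close> fixes the initial state, and
  \<open>p\<close> runs through all choices of the other \<open>l\<close> states. The induction
  splits off the first transition.\<close>

lemma iterated_product_eq_sum_paths:
  assumes "i < n"
  shows "iterated_product n M v l i = (\<Sum>p<n ^ l. path_weight n M v l (i * n ^ l + p))"
  using assms
proof (induction l arbitrary: i)
  case 0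
  then show ?case by (simp add: path_weight_def digit_def)
next
  case (Suc l)
  \<comment> \<open>The weight of a path with \<open>l\<close> transitions reads only the digits up
    to position \<open>l\<close>.\<close>
  have low: "path_weight n M v l (i * n ^ Suc l + q) = path_weight n M v l q" for q
  proof -
    have "(\<Prod>j<l. M j (digit n (i * n ^ Suc l + q) (Suc j)) (digit n (i * n ^ Suc l + q) j)) =
        (\<Prod>j<l. M j (digit n q (Suc j)) (digit n q j))"
      by (intro prod.cong refl) (simp add: digit_add_low del: power_Suc)
    then show ?thesis unfolding path_weight_def by (simp add: digit_add_low del: power_Suc)
  qed
  have "path_weight n M v (Suc l) (i * n ^ Suc l + q) = M l i (digit n q l) * path_weight n M v l q"
    if "q < n ^ Suc l" for q
  proof -
    have "path_weight n M v (Suc l) (i * n ^ Suc l + q) =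
      M l (digit n (i * n ^ Suc l + q) (Suc l)) (digit n (i * n ^ Suc l + q) l)
        * path_weight n M v l (i * n ^ Suc l + q)"
      unfolding path_weight_def by simp
    then show ?thesis
      using that Suc.prems by (simp only: low digit_add_top) (simp add: digit_add_low del: power_Suc)
  qed
  then have "(\<Sum>q<n ^ Suc l. path_weight n M v (Suc l) (i * n ^ Suc l + q)) =
      (\<Sum>q<n * n ^ l. M l i (digit n q l) * path_weight n M v l q)"
    by (intro sum.cong) simp_all
  also have "\<dots> = (\<Sum>j<n. \<Sum>p<n ^ l. M l i j * path_weight n M v l (j * n ^ l + p))"
    unfolding sum_lessThan_mult by (intro sum.cong) (simp_all add: digit_add_top)
  also have "\<dots> = (\<Sum>j<n. M l i j * iterated_product n M v l j)"
    using Suc.IH by (simp add: sum_distrib_left)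
  finally show ?case by simp
qed

text \<open>The row vector frees the initial state as well, hence paths with \<open>Suc l\<close>
  digits.\<close>

lemma sum_iterated_product:
  "(\<Sum>i<n. u i * iterated_product n M v l i) = (\<Sum>q<n ^ Suc l. u (digit n q l) * path_weight n M v l q)"
proof -
  have "(\<Sum>q<n * n ^ l. u (digit n q l) * path_weight n M v l q) =
      (\<Sum>i<n. \<Sum>p<n ^ l. u i * path_weight n M v l (i * n ^ l + p))"
    unfolding sum_lessThan_mult by (intro sum.cong) (simp_all add: digit_add_top)
  then show ?thesis by (simp add: iterated_product_eq_sum_paths sum_distrib_left)
qed

section \<open>Reading and evaluating a representation from its code\<close>

lemma nth_concat_blocks:
  assumes "\<And>xs. xs \<in> set xss \<Longrightarrow> length xs = m" "a < length xss" "r < m"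
  shows "concat xss ! (a * m + r) = xss ! a ! r"
  using assms
proof (induction xss arbitrary: a)
  case (Cons xs xss)
  then show ?case by (cases a) (auto simp: nth_append)
qed simp

lemma nth_concat_mat_to_list:
  assumes "A \<in> carrier_mat n m" "i < n" "j < m"
  shows "concat (mat_to_list A) ! (i * m + j) = A $$ (i, j)"
  using assms by (subst nth_concat_blocks) (auto simp: mat_to_list_def)

text \<open>The offsets follow the layout of the code: the dimension, \<open>n\<close> entries of
  \<lambda>, one row-major block of \<open>n * n\<close> entries per letter, and finally
  \<nu>.\<close>

lemma code_nth_nrep_code:
  fixes R :: "'a::{finite,linorder} nrep"
  assumes R: "nrepresentation R"
  defines "n \<equiv> rdim R" and "c \<equiv> nrep_code R"
  shows "code_nth c 0 = n"
    and "i < n \<Longrightarrow> code_nth c (Suc i) = lam R $ i"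
    and "\<lbrakk>a < CARD('a); i < n; j < n\<rbrakk> \<Longrightarrow>
      code_nth c (Suc (n + (a * (n * n) + (i * n + j)))) = mu R (letter a) $$ (i, j)"
    and "i < n \<Longrightarrow> code_nth c (Suc (n + (CARD('a) * (n * n) + i))) = nu R $ i"
proof -
  let ?m = "map (\<lambda>a. concat (mat_to_list (mu R a))) (sorted_list_of_set UNIV)"
  let ?xs = "n # list_of_vec (lam R) @ concat ?m @ list_of_vec (nu R)"
  have c: "c = list_encode ?xs" by (simp add: c_def nrep_code_def n_def)
  have dims: "dim_vec (lam R) = n" "dim_vec (nu R) = n" and mu: "mu R a \<in> carrier_mat n n" for a
    using R by (auto simp: nrepresentation_def n_def)
  have blocks: "length xs = n * n" if "xs \<in> set ?m" for xs
    using that length_concat_mat_to_list[OF mu] by auto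
  then have len: "length (concat ?m) = CARD('a) * (n * n)"
    by (subst length_concat) (simp add: length_concat_mat_to_list[OF mu] comp_def sum_list_triv)
  have length: "length ?xs = Suc (n + (CARD('a) * (n * n) + n))"
    by (simp only: list.size length_append length_list_of_vec dims len)
  have mid: "code_nth c (Suc (n + p)) = (concat ?m @ list_of_vec (nu R)) ! p"
    if "p < CARD('a) * (n * n) + n" for p
  proof -
    have "Suc (n + p) < length ?xs" unfolding length using that by simp
    then have "code_nth c (Suc (n + p)) = ?xs ! Suc (n + p)"
      unfolding c by (rule code_nth_list_encode)
    also have "\<dots> = (concat ?m @ list_of_vec (nu R)) ! p"
      using nth_append_length_plus[of "list_of_vec (lam R)" "concat ?m @ list_of_vec (nu R)" p]
      by (simp only: nth_Cons_Suc length_list_of_vec dims)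
    finally show ?thesis .
  qed
  show "code_nth c 0 = n"
    unfolding c by (subst code_nth_list_encode) simp_all
  show "code_nth c (Suc i) = lam R $ i" if "i < n"
    unfolding c using that
    by (subst code_nth_list_encode) (simp_all add: dims nth_append list_of_vec_index)
  show "code_nth c (Suc (n + (CARD('a) * (n * n) + i))) = nu R $ i" if "i < n"
  proof -
    have "code_nth c (Suc (n + (CARD('a) * (n * n) + i))) =
        (concat ?m @ list_of_vec (nu R)) ! (CARD('a) * (n * n) + i)"
      using that by (intro mid) simp
    also have "\<dots> = list_of_vec (nu R) ! i"
      using nth_append_length_plus[of "concat ?m" "list_of_vec (nu R)" i] by (simp only: len)
    finally show ?thesis using that by (simp add: list_of_vec_index dims)
  qed
  show "code_nth c (Suc (n + (a * (n * n) + (i * n + j)))) = mu R (letter a) $$ (i, j)"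
    if "a < CARD('a)" "i < n" "j < n"
  proof -
    have "i * n + j < Suc i * n" using that by simp
    also have "\<dots> \<le> n * n" using that by (intro mult_le_mono1) simp
    finally have r: "i * n + j < n * n" .
    then have "a * (n * n) + (i * n + j) < Suc a * (n * n)" by simp
    also have "\<dots> \<le> CARD('a) * (n * n)" using that by (intro mult_le_mono1) simp
    finally have less: "a * (n * n) + (i * n + j) < CARD('a) * (n * n)" .
    have "code_nth c (Suc (n + (a * (n * n) + (i * n + j)))) =
        (concat ?m @ list_of_vec (nu R)) ! (a * (n * n) + (i * n + j))"
      using less by (intro mid) (rule trans_less_add1)
    also have "\<dots> = concat ?m ! (a * (n * n) + (i * n + j))"
      using less by (simp only: nth_append len if_True)
    also have "\<dots> = ?m ! a ! (i * n + j)"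
      using that r blocks by (intro nth_concat_blocks) auto
    also have "\<dots> = mu R (letter a) $$ (i, j)"
      using that mu by (simp add: letter_def nth_concat_mat_to_list[OF mu])
    finally show ?thesis .
  qed
qed

text \<open>The value of the coded series at \<open>word l x\<close>, as a sum over paths through
  \<open>Suc l\<close> states. \<open>k\<close> is the size of the alphabet, which is not part of
  the code.\<close>

definition code_eval :: "nat \<Rightarrow> nat \<Rightarrow> nat \<Rightarrow> nat \<Rightarrow> nat" where
  "code_eval k c l x = (\<Sum>q<code_nth c 0 ^ Suc l.
     code_nth c (Suc (digit (code_nth c 0) q l)) *
     path_weight (code_nth c 0)
       (\<lambda>j i i'. code_nth c (Suc (code_nth c 0 + (digit k x j * (code_nth c 0 * code_nth c 0)
         + (i * code_nth c 0 + i')))))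
       (\<lambda>i. code_nth c (Suc (code_nth c 0 + (k * (code_nth c 0 * code_nth c 0) + i)))) l q)"

lemma code_eval_nrep_code:
  fixes R :: "'a::{finite,linorder} nrep"
  assumes R: "nrepresentation R"
  shows "code_eval CARD('a) (nrep_code R) l x = behaviour R (word l x)"
proof -
  let ?n = "rdim R" and ?k = "CARD('a)" and ?c = "nrep_code R"
  let ?M = "\<lambda>j i i'. code_nth ?c (Suc (?n + (digit ?k x j * (?n * ?n) + (i * ?n + i'))))"
  let ?v = "\<lambda>i. code_nth ?c (Suc (?n + (?k * (?n * ?n) + i)))"
  note code = code_nth_nrep_code[OF R]
  have "digit ?k x j < ?k" for j by (simp add: digit_def)
  note M = code(3)[OF this]
  \<comment> \<open>The matrix at position \<open>j\<close> is that of the letter with index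
    \<open>digit ?k x j\<close>, so both sides satisfy the same recursion in
    \<open>l\<close>.\<close>
  have "iterated_product ?n ?M ?v l i = (mu_word R (word l x) *\<^sub>v nu R) $ i" if "i < ?n" for i
    using that
  proof (induction l arbitrary: i)
    case 0
    then show ?case using mu_word_Nil_nu[OF R] code(4) by (simp del: mu_word.simps)
  next
    case (Suc l)
    then show ?case
      using M by (simp add: mu_word_Cons_nu[OF R] digit_def[symmetric] del: mu_word.simps)
  qed
  then have "behaviour R (word l x) = (\<Sum>i<?n. code_nth ?c (Suc i) * iterated_product ?n ?M ?v l i)"
    using code(2) by (simp add: behaviour_eq_sum[OF R])
  then show ?thesis
    unfolding code_eval_def code(1) by (simp only: sum_iterated_product)
qed

lemma recfn_code_eval: "recfn 3 (\<lambda>xs. code_eval k (xs ! 0) (xs ! 1) (xs ! 2))"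
  unfolding code_eval_def path_weight_def digit_def
  by (intro recfn_intros recfn_code_nth) simp_all

text \<open>Follows the formula of \<open>val_word\<close>, with membership in the support tested by
  \<open>code_eval\<close>.\<close>

definition code_rank :: "nat \<Rightarrow> nat \<Rightarrow> nat \<Rightarrow> nat \<Rightarrow> nat" where
  "code_rank k c l x = (\<Sum>m<l. \<Sum>y<k ^ m. if code_eval k c m y = 0 then 0 else 1)
     + (\<Sum>y<x. if code_eval k c l y = 0 then 0 else 1)"

text \<open>
  With truncated subtraction, \<open>e * ((e - r) + (r - e))\<close> vanishes iff \<open>e = 0\<close> or \<open>e = r\<close>.
\<close>

definition code_mismatch :: "nat \<Rightarrow> nat \<Rightarrow> nat \<Rightarrow> nat" where
  "code_mismatch k c b = (\<Sum>l<b. \<Sum>x<k ^ l. code_eval k c l x *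
     ((code_eval k c l x - Suc (code_rank k c l x)) + (Suc (code_rank k c l x) - code_eval k c l x)))"

text \<open>
  A code \<open>c\<close> bounds the dimension that it contains, so it may replace the dimension in all bounds.
\<close>

definition decide_code :: "nat \<Rightarrow> nat \<Rightarrow> nat" where
  "decide_code k c = (if code_mismatch k c (Suc (2 ^ c * (c + 2 * (2 ^ c + 1)))) = 0
     then if (\<Sum>l<2 ^ c. \<Sum>x<k ^ (2 ^ c + l). code_eval k c (2 ^ c + l) x) = 0 then 0 else 1
     else 0)"

lemma recfn_decide_code: "recfn 1 (\<lambda>xs. decide_code k (xs ! 0))"
proof -
  have rank: "recfn 3 (\<lambda>xs. code_rank k (xs ! 0) (xs ! 1) (xs ! 2))"
    unfolding code_rank_def by (intro recfn_intros recfn_comp3[OF recfn_code_eval]) simp_all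
  have mismatch: "recfn 2 (\<lambda>xs. code_mismatch k (xs ! 0) (xs ! 1))"
    unfolding code_mismatch_def
    by (intro recfn_intros recfn_comp3[OF recfn_code_eval] recfn_comp3[OF rank]) simp_all
  show ?thesis
    unfolding decide_code_def
    by (intro recfn_intros recfn_comp2[OF mismatch] recfn_comp3[OF recfn_code_eval]) simp_all
qed

lemma all_words_iff:
  "(\<forall>w :: 'a::{finite,linorder} list. length w = l \<longrightarrow> P w) \<longleftrightarrow> (\<forall>x<CARD('a) ^ l. P (word l x))"
proof (intro iffI allI impI)
  fix w :: "'a list" assume *: "\<forall>x<CARD('a) ^ l. P (word l x)" "length w = l"
  obtain x where "x < CARD('a) ^ length w" "w = word (length w) x" by (rule obtain_word)
  with * show "P w" by metis
qed simp

lemma code_rank_nrep_code: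
  fixes R :: "'a::{finite,linorder} nrep"
  assumes "nrepresentation R" "x < CARD('a) ^ l"
  shows "code_rank CARD('a) (nrep_code R) l x = val {w. behaviour R w \<noteq> 0} (word l x)"
proof -
  have "(if e \<noteq> 0 then 1 else 0) = (if e = 0 then 0 else (1 :: nat))" for e :: nat by simp
  then show ?thesis
    unfolding code_rank_def val_word[OF assms(2)] code_eval_nrep_code[OF assms(1)]
    by (simp only: mem_Collect_eq)
qed

lemma decide_code_nrep_code:
  fixes R :: "'a::{finite,linorder} nrep"
  assumes R: "nrepresentation R"
  defines "L \<equiv> {w. behaviour R w \<noteq> 0}"
  shows "decide_code CARD('a) (nrep_code R) =
    (if infinite L \<and> behaviour R = enumerating_series L then 1 else 0)"
proof -
  define c where "c = nrep_code R"
  define b where "b = 2 ^ c * (c + 2 * (2 ^ c + 1))"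
  have dim: "rdim R \<le> c" unfolding c_def nrep_code_def
    by (simp add: le_SucI le_prod_encode_1)
  have "rdim R < 2 ^ rdim R" by simp
  have pow: "(2 :: nat) ^ rdim R \<le> 2 ^ c" using dim by (intro power_increasing) auto
  have eval: "code_eval CARD('a) c l x = behaviour R (word l x)" for l x
    using code_eval_nrep_code[OF R] by (simp add: c_def)
  have ser: "behaviour R w = enumerating_series L w \<longleftrightarrow>
      behaviour R w = 0 \<or> behaviour R w = Suc (val L w)" for w
    by (auto simp: enumerating_series_def L_def)
  \<comment> \<open>The sum runs over lengths strictly below its bound, so \<open>Suc b\<close>
    covers all lengths up to \<open>b\<close>.\<close>
  have "code_mismatch CARD('a) c (Suc b) = 0 \<longleftrightarrow>
      (\<forall>l\<le>b. \<forall>x<CARD('a) ^ l. behaviour R (word l x) = enumerating_series L (word l x))"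
  proof -
    have rank: "code_rank CARD('a) c l x = val L (word l x)" if "x < CARD('a) ^ l" for l x
      using code_rank_nrep_code[OF R that] by (simp add: c_def L_def)
    have mismatch: "e * ((e - r) + (r - e)) = 0 \<longleftrightarrow> e = 0 \<or> e = r" for e r :: nat by auto
    have "code_mismatch CARD('a) c (Suc b) = 0 \<longleftrightarrow> (\<forall>l\<le>b. \<forall>x<CARD('a) ^ l.
        behaviour R (word l x) = 0 \<or> behaviour R (word l x) = Suc (code_rank CARD('a) c l x))"
      unfolding code_mismatch_def eval
      by (simp only: sum_eq_0_iff finite_lessThan mismatch) (simp only: lessThan_iff Ball_def less_Suc_eq_le)
    then show ?thesis
      by (simp only: ser) (intro all_cong1 imp_cong refl, simp only: rank)
  qed
  also have "\<dots> \<longleftrightarrow> (\<forall>w. length w \<le> b \<longrightarrow> behaviour R w = enumerating_series L w)"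
    by (simp only: all_words_iff[where P = "\<lambda>w. behaviour R w = enumerating_series L w", symmetric]) auto
  also have "\<dots> \<longleftrightarrow> behaviour R = enumerating_series L"
    using eq_enumerating_series_iff[OF R dim] by (simp add: L_def b_def)
  finally have mismatch: "code_mismatch CARD('a) c (Suc b) = 0 \<longleftrightarrow> behaviour R = enumerating_series L" .
  \<comment> \<open>The second sum inspects the lengths from \<open>2 ^ c\<close> to
    \<open>2 * 2 ^ c - 1\<close>, the window of \<open>infinite_support_iff\<close>.\<close>
  have "(\<Sum>l<2 ^ c. \<Sum>x<CARD('a) ^ (2 ^ c + l). code_eval CARD('a) c (2 ^ c + l) x) = 0 \<longleftrightarrow>
      (\<forall>l<2 ^ c. \<forall>x<CARD('a) ^ (2 ^ c + l). behaviour R (word (2 ^ c + l) x) = 0)"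
    unfolding eval by auto
  also have "\<dots> \<longleftrightarrow> (\<forall>l<2 ^ c. \<forall>w. length w = 2 ^ c + l \<longrightarrow> behaviour R w = 0)"
    by (simp only: all_words_iff)
  also have "\<dots> \<longleftrightarrow> finite L"
    using infinite_support_iff[OF R pow] by (auto simp: L_def)
  finally show ?thesis
    using mismatch unfolding decide_code_def c_def[symmetric] b_def[symmetric] by simp
qed

theorem theorem2:
  shows "decidable_for_nrational
    (\<lambda>s :: 'a::{finite,linorder} list \<Rightarrow> nat. \<exists>L. is_ans L \<and> s = enumerating_series L)"
proof -
  \<comment> \<open>The type fixes the size of the alphabet, so one function of the code serves all
    representations, whatever their dimension.\<close>
  obtain f where f: "total_recursive 1 f" "\<forall>xs. length xs = 1 \<longrightarrow> decide_code CARD('a) (xs ! 0) = f xs"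
    using recfn_decide_code[of "CARD('a)"] unfolding recfn_def by blast
  have f_code: "decide_code CARD('a) c = f [c]" for c using f(2)[rule_format, of "[c]"] by simp
  show ?thesis
    unfolding decidable_for_nrational_def
  proof (intro exI[of _ f] conjI allI impI f(1))
    fix s :: "'a list \<Rightarrow> nat" and R assume "represents R s"
    then have R: "nrepresentation R" and s: "s = behaviour R" by (auto simp: represents_def)
    show "f [nrep_code R] = (if \<exists>L. is_ans L \<and> s = enumerating_series L then 1 else 0)"
      unfolding f_code[symmetric] ex_enumerating_series_iff decide_code_nrep_code[OF R] s ..
  qed
qed

end
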